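(* Let $q\ge3$, let $g\in\mathbb{F}_q[t]$ be a non-constant square-free polynomial that is not a Carmichael polynomial, and let $\ell$ be a prime factor of $q-1$. Then there exist infinitely many cyclic extensions $K$ of $\mathbb{F}_q(t)$ of degree $\ell$ whose discriminants are relatively prime to $g$ such that $g$ is not Carmichael in $K$.
   Context: $\mathbb{F}_q$ is the finite field with $q$ elements. A finite ring $S$ is a Carmichael ring if $S$ is not a field and $a^{|S|}=a$ for every $a\in S$; an ideal $I$ of a ring $R$ is a Carmichael ideal if $R/I$ is a Carmichael ring. A polynomial $g\in\mathbb{F}_q[t]$ is a Carmichael polynomial if $(g)$ is a Carmichael ideal of $\mathbb{F}_q[t]$. For a finite extension $K$ of $\mathbb{F}_q(t)$, $\mathcal{O}_K$ denotes the integral closure of $\mathbb{F}_q[t]$ in $K$, and an element $\alpha\in\mathcal{O}_K$ is Carmichael in $K$ if $\alpha\mathcal{O}_K$ is a Carmichael ideal of $\mathcal{O}_K$. The discriminant of $K$ is the discriminant ideal of $\mathcal{O}_K$ over $\mathbb{F}_q[t]$; "relatively prime to $g$" means no irreducible factor of $g$ divides it. *)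

theory Defs
  imports "HOL-Algebra.QuotRing" "HOL-Algebra.RingHom"
    "HOL-Computational_Algebra.Polynomial" "HOL-Computational_Algebra.Fraction_Field"
    "HOL-Computational_Algebra.Squarefree" "HOL-Combinatorics.Permutations"
begin

definition carmichael_ring :: "('r, 'b) ring_scheme \<Rightarrow> bool" where
  "carmichael_ring S \<longleftrightarrow> finite (carrier S) \<and> \<not> field S \<and>
     (\<forall>a\<in>carrier S. a [^]\<^bsub>S\<^esub> card (carrier S) = a)"

definition carmichael_ideal :: "('r, 'b) ring_scheme \<Rightarrow> 'r set \<Rightarrow> bool" where
  "carmichael_ideal R I \<longleftrightarrow> carmichael_ring (R Quot I)"

definition poly_ring :: "'a::field poly ring" where
  "poly_ring = \<lparr>carrier = UNIV, monoid.mult = (*), one = 1, zero = 0, add = (+)\<rparr>"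

definition carmichael_poly :: "'a::field poly \<Rightarrow> bool" where
  "carmichael_poly g \<longleftrightarrow> carmichael_ideal poly_ring (PIdl\<^bsub>poly_ring\<^esub> g)"

text \<open>F_q(t) is the type 'a poly fract; a finite extension K of degree n is
  F_q(t)[X]/(h) with h irreducible of degree n, whose elements are represented by
  the remainders (polynomials of degree < n).\<close>

abbreviation emb :: "'a::field poly \<Rightarrow> 'a poly fract" where
  "emb a \<equiv> Fract a 1"

definition Kset :: "'a::field poly fract poly \<Rightarrow> 'a poly fract poly set" where
  "Kset h = {r. degree r < degree h}"

definition Kring :: "'a::field poly fract poly \<Rightarrow> 'a poly fract poly ring" where
  "Kring h = \<lparr>carrier = Kset h, monoid.mult = (\<lambda>x y. (x * y) mod h), one = 1,
              zero = 0, add = (+)\<rparr>"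

definition Kaut :: "'a::field poly fract poly \<Rightarrow> ('a poly fract poly \<Rightarrow> 'a poly fract poly) set" where
  "Kaut h = {\<sigma>. \<sigma> \<in> ring_iso (Kring h) (Kring h) \<and> \<sigma> \<in> extensional (Kset h) \<and>
                 (\<forall>c. \<sigma> [:c:] = [:c:])}"

text \<open>Cyclic extension of degree n: a field extension of degree n which is Galois
  (number of automorphisms = degree) with cyclic automorphism group.\<close>
definition cyclic_ext :: "nat \<Rightarrow> 'a::field poly fract poly \<Rightarrow> bool" where
  "cyclic_ext n h \<longleftrightarrow> irreducible h \<and> degree h = n \<and> card (Kaut h) = n \<and>
     (\<exists>\<sigma>\<in>Kaut h. \<forall>\<tau>\<in>Kaut h. \<exists>k. \<forall>x\<in>Kset h. \<tau> x = (\<sigma> ^^ k) x)"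

definition ext_iso :: "'a::field poly fract poly \<Rightarrow> 'a poly fract poly \<Rightarrow> bool" where
  "ext_iso h1 h2 \<longleftrightarrow> (\<exists>\<phi>\<in>ring_iso (Kring h1) (Kring h2). \<forall>c. \<phi> [:c:] = [:c:])"

definition OK :: "'a::field poly fract poly \<Rightarrow> 'a poly fract poly set" where
  "OK h = {x \<in> Kset h. \<exists>p :: 'a poly poly. lead_coeff p = 1 \<and>
             poly (map_poly (\<lambda>a. [:emb a:]) p) x mod h = 0}"

definition OK_ring :: "'a::field poly fract poly \<Rightarrow> 'a poly fract poly ring" where
  "OK_ring h = (Kring h)\<lparr>carrier := OK h\<rparr>"

text \<open>Trace of K over F_q(t): trace of multiplication by x w.r.t. the basis
  1, X, ..., X^(n-1).\<close>
definition Ktrace :: "'a::field poly fract poly \<Rightarrow> 'a poly fract poly \<Rightarrow> 'a poly fract" where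
  "Ktrace h x = (\<Sum>i<degree h. coeff ((x * monom 1 i) mod h) i)"

text \<open>Discriminant of an n-tuple: det (Tr(b_i b_j)), Leibniz formula.\<close>
definition Kdisc :: "'a::field poly fract poly \<Rightarrow> (nat \<Rightarrow> 'a poly fract poly) \<Rightarrow> 'a poly fract" where
  "Kdisc h b = (\<Sum>\<pi> | \<pi> permutes {..<degree h}. of_int (sign \<pi>) *
        (\<Prod>i<degree h. Ktrace h ((b i * b (\<pi> i)) mod h)))"

text \<open>Generators (in F_q[t]) of the discriminant ideal of O_K over F_q[t]: discriminants
  of n-tuples of elements of O_K.\<close>
definition disc_gens :: "'a::field poly fract poly \<Rightarrow> 'a poly set" where
  "disc_gens h = {d. \<exists>b. (\<forall>i<degree h. b i \<in> OK h) \<and> emb d = Kdisc h b}"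

text \<open>The discriminant (ideal) is relatively prime to g: no irreducible factor of g
  divides it (i.e. contains the ideal).\<close>
definition disc_coprime :: "'a::field poly fract poly \<Rightarrow> 'a poly \<Rightarrow> bool" where
  "disc_coprime h g \<longleftrightarrow> (\<forall>p. irreducible p \<and> p dvd g \<longrightarrow> \<not> (\<forall>d\<in>disc_gens h. p dvd d))"

definition carmichael_in :: "'a::field poly fract poly \<Rightarrow> 'a poly \<Rightarrow> bool" where
  "carmichael_in h g \<longleftrightarrow> carmichael_ideal (OK_ring h) (PIdl\<^bsub>OK_ring h\<^esub> [:emb g:])"

end

theory Submission
  imports "HOL-Algebra.Multiplicative_Group" "HOL-Number_Theory.Cong"
    "HOL-Computational_Algebra.Polynomial_Factorial" Defs
begin

text \<open>
  Write $A = \mathbb{F}_q[t]$. Since $g$ is not Carmichael, Korselt's criterion yields a prime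
  $p \mid g$ with $p = g$ up to units or $\deg p \nmid \deg g$. Take the Kummer extension
  $K = \mathbb{F}_q(t)(\sqrt[l]{m})$ with $m$ prime to $g$ and not an $l$-th power modulo $p$.
  The discriminant of $1, X, \dots, X^{l-1}$ is $\pm l^l m^{l-1}$, hence prime to $g$. The prime $p$ is
  inert: a nonzero ideal of $A[X]/(p, X^l - m)$ is stable under the $q^{\deg p}$-power map, which is
  diagonal on the powers of $X$ with distinct eigenvalues, so the ideal contains a monomial, that is,
  a unit. If $g$ is irreducible, then $\mathcal{O}_K/g$ is a field. Otherwise the Carmichael property
  would make the exponent $q^{l \deg g}$ act trivially on the field $\mathcal{O}_K/p$ with $q^{l \deg p}$
  elements, so that $\deg p \mid \deg g$.

  By the Chinese remainder theorem $m$ can also be made exactly divisible by a new prime $r$. An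
  isomorphism between two such fields forces $m_1 = c^l m_2^j$ with $0 < j < l$, which contradicts the
  valuations at $r$.

  Integrality in $K$ is handled through the $q$-power map as well, which avoids the general theory of
  integral closures: $x = \sum c_i X^i$ is integral if and only if all $c_i^l m^i$ lie in $A$.
\<close>

section \<open>Polynomials over a field\<close>

text \<open>Everything rests on \<open>q = 1\<close> modulo \<open>l\<close>. This congruence puts
  the l-th roots of unity into F_q, which makes K Galois, and it makes \<open>l\<close> invertible.
  With \<open>e = (q^k - 1)/l\<close> it also gives \<open>(c X^i)^(q^k) = w^e * c X^i\<close>,
  where \<open>w = c^l m^i\<close> is just \<open>(c X^i)^l\<close>. This explains the integrality
  criterion: the powers \<open>q^k\<close> let every coefficient be examined separately, and if all
  \<open>w^e\<close> share one denominator while \<open>e\<close> grows, then \<open>w\<close> lies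
  in A. Conversely, if \<open>w\<close> lies in A, then \<open>T^q - w^((q-1)/l) T\<close> kills
  \<open>c X^i\<close>.

  Since \<open>m\<close> may have repeated factors, A[X] can be strictly smaller than O_K. The gap
  does no harm: \<open>m\<close> O_K lies in A[X], and \<open>m\<close> is invertible modulo
  \<open>g\<close> and modulo \<open>p\<close>, so residues can be computed in A[X].

  Modulo \<open>p\<close> the eigenvalue on \<open>X\<close> is a power of \<open>m\<close> that is
  a primitive l-th root of unity exactly because \<open>m\<close> is a non-residue; this is why the
  eigenvalues are distinct.

  Passing from A to O_K multiplies both \<open>deg p\<close> and \<open>deg g\<close> by
  \<open>l\<close>. The factor cancels, so the failure of Korselt's divisibility in A survives in
  K.\<close>

lemma field_poly_bezout:
  fixes a b :: "'a::field poly"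
  assumes "coprime a b"
  shows "\<exists>u v. u * a + v * b = 1"
proof (cases "a = 0 \<and> b = 0")
  case True
  with assms show ?thesis by simp
next
  case False
  define I where "I = {d. d \<noteq> 0 \<and> (\<exists>u v. d = u * a + v * b)}"
  have "I \<noteq> {}"
  proof (cases "a = 0")
    case True
    with False have "b \<in> I" by (auto simp: I_def intro!: exI[of _ 0] exI[of _ 1])
    thus ?thesis by auto
  next
    case False
    have "a = 1 * a + 0 * b" by simp
    with False have "a \<in> I" unfolding I_def by blast
    thus ?thesis by auto
  qed
  then obtain d where d: "d \<in> I" and min: "\<And>e. e \<in> I \<Longrightarrow> degree d \<le> degree e"
    using arg_min_nat_lemma[of "\<lambda>x. x \<in> I" _ degree] by (metis equals0I)
  then obtain u v where uv: "d = u * a + v * b" and d0: "d \<noteq> 0" by (auto simp: I_def)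
  \<comment> \<open>A nonzero remainder of a combination modulo \<open>d\<close> would again be a
    combination, of smaller degree than the minimal \<open>d\<close>.\<close>
  have dvd: "d dvd s * a + t * b" for s t
  proof (rule ccontr)
    let ?c = "s * a + t * b"
    assume "\<not> d dvd ?c"
    hence r0: "?c mod d \<noteq> 0" by (simp add: mod_eq_0_iff_dvd)
    have "?c mod d = ?c - (?c div d) * d" by (simp add: minus_div_mult_eq_mod)
    also have "\<dots> = (s - (?c div d) * u) * a + (t - (?c div d) * v) * b"
      using uv by (simp add: algebra_simps)
    finally have "?c mod d \<in> I" using r0 unfolding I_def by blast
    moreover have "degree (?c mod d) < degree d" using d0 r0 by (metis degree_mod_less)
    ultimately show False using min by fastforce
  qed
  have "d dvd a" "d dvd b" using dvd[of 1 0] dvd[of 0 1] by auto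
  with assms have "d dvd 1" by (meson coprime_def)
  then obtain e where "1 = d * e" by (auto elim: dvdE)
  hence "(e * u) * a + (e * v) * b = 1" using uv by (simp add: algebra_simps)
  thus ?thesis by blast
qed

lemma field_poly_irreducible_bezout:
  fixes p a :: "'a::field poly"
  assumes "irreducible p" "\<not> p dvd a"
  shows "\<exists>u v. u * p + v * a = 1"
proof (rule field_poly_bezout)
  show "coprime p a"
  proof (rule coprimeI)
    fix c assume c: "c dvd p" "c dvd a"
    then obtain e where "p = c * e" by (auto elim: dvdE)
    with assms(1) have "c dvd 1 \<or> e dvd 1" by (auto dest: irreducibleD)
    moreover have "\<not> e dvd 1"
    proof
      assume "e dvd 1"
      with \<open>p = c * e\<close> have "p dvd c" by simp
      thus False using c(2) assms(2) dvd_trans by blast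
    qed
    ultimately show "c dvd 1" by blast
  qed
qed

lemma irreducible_dvd_field_poly_exists:
  fixes a :: "'a::field poly"
  assumes "degree a > 0"
  shows "\<exists>p. irreducible p \<and> p dvd a"
  using assms
proof (induction "degree a" arbitrary: a rule: less_induct)
  case less
  show ?case
  proof (cases "irreducible a")
    case False
    have "a \<noteq> 0" using less.prems by auto
    hence "\<not> a dvd 1" using less.prems by (simp add: is_unit_iff_degree)
    with False \<open>a \<noteq> 0\<close> obtain b c where bc: "a = b * c" "\<not> b dvd 1" "\<not> c dvd 1"
      by (auto simp: irreducible_def)
    with \<open>a \<noteq> 0\<close> have "b \<noteq> 0" "c \<noteq> 0" by auto
    with bc have "degree b > 0" "degree c > 0" by (auto simp: is_unit_iff_degree)
    moreover from this bc \<open>b \<noteq> 0\<close> \<open>c \<noteq> 0\<close> have "degree b < degree a" by (simp add: degree_mult_eq)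
    ultimately obtain p where "irreducible p" "p dvd b" using less.hyps by blast
    with bc show ?thesis by (metis dvd_mult2)
  qed auto
qed

lemma irreducible_degree_pos:
  fixes p :: "'a::field poly"
  assumes "irreducible p"
  shows "degree p > 0"
  using assms is_unit_iff_degree[of p] by (auto simp: irreducible_def)

lemma irreducible_power_dvd_degree:
  fixes p a b :: "'a::field poly"
  assumes "irreducible p" "\<not> p dvd a" "b \<noteq> 0" "p ^ n dvd b * a ^ n"
  shows "n \<le> degree b"
proof -
  have "prime_elem p" using assms(1) by (rule field_poly_irreducible_imp_prime)
  moreover from this assms(2) have "\<not> p dvd a ^ n" by (meson prime_elem_dvd_power)
  ultimately have "p ^ n dvd b"
    using assms(4) prime_power_dvd_multD[of p n "a ^ n" b] by (cases "n = 0") (auto simp: mult.commute)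
  hence "degree (p ^ n) \<le> degree b" using assms(3) by (rule dvd_imp_degree_le)
  moreover have "degree (p ^ n) = n * degree p"
    using assms(1) by (subst degree_power_eq) auto
  ultimately show ?thesis using irreducible_degree_pos[OF assms(1)]
    by (metis One_nat_def Suc_leI le_trans mult.right_neutral mult_le_mono2)
qed

lemma infinitely_many_irreducible_poly:
  fixes N :: "'a::field poly"
  assumes "N \<noteq> 0"
  shows "\<exists>p. irreducible p \<and> \<not> p dvd N"
proof -
  \<comment> \<open>Euclid's argument with \<open>t N + 1\<close>; the factor \<open>t\<close> keeps
    the polynomial non-constant even when \<open>N\<close> is constant.\<close>
  define f where "f = [:0, 1:] * N + 1"
  have "degree ([:0, 1:] * N) = Suc (degree N)" using assms by (subst degree_mult_eq) auto
  hence "degree f > 0" unfolding f_def by (subst degree_add_eq_left) auto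
  then obtain p where p: "irreducible p" "p dvd f" using irreducible_dvd_field_poly_exists by blast
  have "\<not> p dvd N"
  proof
    assume "p dvd N"
    hence "p dvd [:0, 1:] * N" by (rule dvd_mult)
    with p(2) have "p dvd 1" unfolding f_def by (simp add: dvd_add_right_iff)
    with p(1) show False by (auto simp: irreducible_def)
  qed
  with p show ?thesis by blast
qed

section \<open>Integral elements of the fraction field\<close>

lemma to_fract_power [simp]: "to_fract (x ^ n) = to_fract x ^ n"
  by (induction n) auto

lemma to_fract_of_nat [simp]: "to_fract (of_nat n) = of_nat n"
  by (induction n) auto

lemma fract_eq_quotient:
  obtains a b where "c = to_fract a / to_fract b" "b \<noteq> 0"
  by (cases c) (auto simp: Fract_conv_to_fract)

lemma range_to_fract_uminus: "x \<in> range to_fract \<Longrightarrow> - x \<in> range to_fract"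
  by (metis imageE rangeI to_fract_uminus)

lemma range_to_fract_power: "x \<in> range to_fract \<Longrightarrow> x ^ n \<in> range to_fract"
  by (metis imageE rangeI to_fract_power)

lemma range_to_fract_closed:
  assumes "x \<in> range to_fract" "y \<in> range to_fract"
  shows "x + y \<in> range to_fract" "x - y \<in> range to_fract" "x * y \<in> range to_fract"
proof -
  from assms obtain a b where "x = to_fract a" "y = to_fract b" by blast
  hence "x + y = to_fract (a + b)" "x - y = to_fract (a - b)" "x * y = to_fract (a * b)" by simp_all
  thus "x + y \<in> range to_fract" "x - y \<in> range to_fract" "x * y \<in> range to_fract"
    by (simp_all only: rangeI)
qed

lemma range_to_fractI [simp, intro]:
  "to_fract a \<in> range to_fract" "0 \<in> range to_fract" "1 \<in> range to_fract"
  by (rule rangeI, metis rangeI to_fract_0, metis rangeI to_fract_1)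

lemma range_to_fract_sum:
  assumes "\<And>i. i \<in> I \<Longrightarrow> f i \<in> range to_fract"
  shows "sum f I \<in> range to_fract"
  using assms
proof (induction I rule: infinite_finite_induct)
  case (insert x F)
  then show ?case by (auto intro!: range_to_fract_closed)
qed auto

text \<open>A is completely integrally closed. In a denominator \<open>b\<close> of least degree, a
  prime \<open>p\<close> does not divide the numerator \<open>a\<close>; then
  \<open>d a^n = z b^n\<close> forces \<open>p^n\<close> to divide \<open>d\<close>, which fails for
  large \<open>n\<close>. Only arbitrarily large exponents are required, since later they run
  through the values \<open>(q^k - 1)/l\<close>.\<close>

lemma integral_of_bounded_denominators:
  fixes c :: "'a::field poly fract"
  assumes d: "d \<noteq> 0" and *: "\<And>N. \<exists>n\<ge>N. to_fract d * c ^ n \<in> range to_fract"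
  shows "c \<in> range to_fract"
proof -
  let ?P = "\<lambda>b. b \<noteq> 0 \<and> to_fract b * c \<in> range to_fract"
  obtain a0 b0 where "c = to_fract a0 / to_fract b0" "b0 \<noteq> 0" by (rule fract_eq_quotient)
  hence "?P b0" by auto
  then obtain b where b: "?P b" and min: "\<And>b'. ?P b' \<Longrightarrow> degree b \<le> degree b'"
    using arg_min_nat_lemma[of ?P b0 degree] by blast
  from b obtain a where a: "to_fract b * c = to_fract a" by auto
  show ?thesis
  proof (cases "degree b = 0")
    case True
    with b obtain e where "b * e = 1" by (metis dvdE is_unit_iff_degree)
    hence "c = to_fract (e * b) * c" by (simp add: mult.commute)
    also have "\<dots> = to_fract (e * a)" using a by (simp add: mult.assoc)
    finally show ?thesis by (simp only: rangeI)
  next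
    case False
    then obtain p where p: "irreducible p" "p dvd b" using irreducible_dvd_field_poly_exists by blast
    then obtain b' where b': "b = p * b'" by (auto elim: dvdE)
    have pa: "\<not> p dvd a"
    proof
      assume "p dvd a"
      then obtain a' where "a = p * a'" by (auto elim: dvdE)
      with a b' p have "to_fract b' * c = to_fract a'" by (auto simp: irreducible_def mult.assoc)
      with b b' have "?P b'" by auto
      hence "degree b \<le> degree b'" by (rule min)
      moreover have "degree b = degree p + degree b'" using b b' by (auto simp: degree_mult_eq)
      ultimately show False using irreducible_degree_pos[OF p(1)] by simp
    qed
    obtain n where n: "n \<ge> Suc (degree d)" and "to_fract d * c ^ n \<in> range to_fract" using * by blast
    then obtain z where "to_fract d * c ^ n = to_fract z" by auto
    hence "to_fract d * (to_fract b * c) ^ n = to_fract (z * b ^ n)"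
      by (simp add: power_mult_distrib)
    hence "to_fract (d * a ^ n) = to_fract (z * b ^ n)" using a by simp
    hence "d * a ^ n = z * b ^ n" by (simp only: to_fract_eq_iff)
    hence "p ^ n dvd d * a ^ n" using p(2) by (simp add: dvd_power_same)
    with irreducible_power_dvd_degree[OF p(1) pa d] n show ?thesis by fastforce
  qed
qed

lemma integrally_closed_power:
  fixes c :: "'a::field poly fract"
  assumes "c ^ n \<in> range to_fract" "n > 0"
  shows "c \<in> range to_fract"
proof (rule integral_of_bounded_denominators[of 1])
  fix N
  have "c ^ (n * N) \<in> range to_fract" using assms(1) by (simp add: power_mult range_to_fract_power)
  with assms(2) show "\<exists>k\<ge>N. to_fract 1 * c ^ k \<in> range to_fract" by (intro exI[of _ "n * N"]) auto
qed auto

section \<open>Finite fields\<close>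

lemma finite_field_power_card:
  fixes x :: "'a::{field,finite}"
  shows "x ^ card (UNIV :: 'a set) = x"
proof (cases "x = 0")
  case False
  let ?U = "UNIV - {0 :: 'a}"
  have "prod id ?U = prod (\<lambda>y. x * y) ?U"
    by (rule prod.reindex_bij_witness[of _ "\<lambda>y. x * y" "\<lambda>y. y / x"]) (use False in auto)
  also have "\<dots> = x ^ card ?U * prod id ?U" by (simp add: prod.distrib)
  finally have "x ^ card ?U = 1" by simp
  moreover have "card (UNIV :: 'a set) = Suc (card ?U)"
    by (metis Diff_insert_absorb card.remove finite iso_tuple_UNIV_I)
  ultimately show ?thesis by (simp only: power_Suc mult_1_right)
qed (simp add: card_gt_0_iff)

text \<open>If 1 were the only solution, then with \<open>k = (q - 1)/l\<close> every nonzero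
  \<open>x\<close> would satisfy \<open>x ^ k = 1\<close>, giving \<open>X^k - 1\<close> as many as
  \<open>q - 1 > k\<close> roots.\<close>

lemma finite_field_root_of_unity:
  fixes l :: nat
  assumes l: "prime l" "l dvd card (UNIV :: 'a::{field,finite} set) - 1"
  shows "\<exists>z::'a. z ^ l = 1 \<and> z \<noteq> 1"
proof (rule ccontr)
  assume *: "\<nexists>z::'a. z ^ l = 1 \<and> z \<noteq> 1"
  let ?q = "card (UNIV :: 'a set)"
  have q1: "?q > 1" using card_mono[of "UNIV :: 'a set" "{0, 1}"] by simp
  from l(2) obtain k where k: "?q - 1 = l * k" by (auto elim: dvdE)
  have k0: "k > 0" using k q1 by (cases k) auto
  have kq: "k < ?q - 1" using k k0 prime_gt_1_nat[OF l(1)] by simp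
  have "x ^ k = 1" if "x \<noteq> 0" for x :: 'a
  proof -
    have "x * x ^ (?q - 1) = x" using finite_field_power_card[of x] q1 by (cases ?q) auto
    hence "x ^ (?q - 1) = 1" using that by simp
    hence "(x ^ k) ^ l = 1" unfolding k by (simp add: mult.commute flip: power_mult)
    with * show ?thesis by blast
  qed
  hence "UNIV - {0} \<subseteq> {x::'a. poly (monom 1 k - 1) x = 0}" by (auto simp: poly_monom)
  hence "card (UNIV - {0::'a}) \<le> card {x::'a. poly (monom 1 k - 1) x = 0}" by (intro card_mono) auto
  also have deg: "degree (monom 1 k - 1 :: 'a poly) = k"
    using k0 degree_add_eq_left[of "-1" "monom 1 k :: 'a poly"] by (simp add: degree_monom_eq)
  hence "card {x::'a. poly (monom 1 k - 1) x = 0} \<le> k"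
    using card_poly_roots_bound[of "monom 1 k - 1 :: 'a poly"] k0 by (metis degree_0 less_numeral_extra(3))
  finally show False using kq by (simp add: card_Diff_subset)
qed

text \<open>The polynomial \<open>(x + 1)^q - x^q - 1\<close> has degree below \<open>q\<close> and
  vanishes at all \<open>q\<close> elements, hence is zero. In this way \<open>q\<close> need not be
  written as a power of the characteristic.\<close>

lemma finite_field_of_nat_binomial:
  fixes k :: nat
  assumes "0 < k" "k < card (UNIV :: 'a::{field,finite} set)"
  shows "of_nat (card (UNIV :: 'a set) choose k) = (0 :: 'a)"
proof -
  let ?q = "card (UNIV :: 'a set)"
  define f where "f = (\<Sum>j\<in>{0<..<?q}. monom (of_nat (?q choose j)) j :: 'a poly)"
  have "f = 0"
  proof (rule poly_eqI_degree[of UNIV])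
    show "card (UNIV :: 'a set) > degree f"
      unfolding f_def using assms
      by (intro degree_sum_less) (auto intro: le_less_trans[OF degree_monom_le])
    fix x :: 'a
    have "x + 1 = (x + 1) ^ ?q" by (simp add: finite_field_power_card)
    also have "\<dots> = (\<Sum>j\<le>?q. of_nat (?q choose j) * x ^ j)" by (simp add: binomial_ring)
    also have "{..?q} = insert 0 (insert ?q {0<..<?q})" using assms by auto
    also have "(\<Sum>j\<in>\<dots>. of_nat (?q choose j) * x ^ j) = 1 + x + poly f x"
      using assms by (simp add: f_def poly_sum poly_monom finite_field_power_card)
    finally show "poly f x = poly 0 x" by simp
  qed (use assms in auto)
  hence "coeff f k = 0" by simp
  also have "coeff f k = of_nat (?q choose k)"
    using assms unfolding f_def by (simp add: coeff_sum)
  finally show ?thesis .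
qed

lemma finite_field_of_nat_divisor_neq_0:
  assumes "l dvd card (UNIV :: 'a::{field,finite} set) - 1"
  shows "of_nat l \<noteq> (0 :: 'a)"
proof
  assume 0: "of_nat l = (0 :: 'a)"
  let ?q = "card (UNIV :: 'a set)"
  have q1: "?q > 1" using card_mono[of "UNIV :: 'a set" "{0, 1}"] by simp
  \<comment> \<open>The binomial coefficient \<open>q choose 1\<close> is \<open>q\<close> itself.
    So \<open>q = l k + 1\<close> would read \<open>0 = 1\<close> in the field if \<open>l\<close>
    vanished there.\<close>
  have "of_nat ?q = (0 :: 'a)" using finite_field_of_nat_binomial[of 1, where 'a='a] q1 by simp
  moreover from assms obtain k where "?q - 1 = l * k" by (auto elim: dvdE)
  hence "?q = l * k + 1" using q1 by simp
  ultimately show False using 0 by simp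
qed

text \<open>The hypothesis transports the vanishing of binomial coefficients from F_q to the ring
  \<open>'b\<close>. It expresses that the characteristic of \<open>'b\<close> divides that of F_q,
  without naming either.\<close>

lemma add_power_finite_field_card:
  fixes x y :: "'b::comm_ring_1"
  assumes "\<And>n. of_nat n = (0 :: 'a::{field,finite}) \<Longrightarrow> of_nat n = (0 :: 'b)"
  shows "(x + y) ^ (card (UNIV :: 'a set) ^ k) = x ^ (card (UNIV :: 'a set) ^ k) + y ^ (card (UNIV :: 'a set) ^ k)"
proof (induction k arbitrary: x y)
  case (Suc k)
  let ?q = "card (UNIV :: 'a set)"
  have q1: "?q > 1" using card_mono[of "UNIV :: 'a set" "{0, 1}"] by simp
  have "(x + y) ^ ?q = (\<Sum>j\<le>?q. of_nat (?q choose j) * x ^ j * y ^ (?q - j))"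
    by (rule binomial_ring)
  also have "\<dots> = (\<Sum>j\<in>{0, ?q}. of_nat (?q choose j) * x ^ j * y ^ (?q - j))"
  proof (rule sum.mono_neutral_right)
    show "\<forall>i\<in>{..?q} - {0, ?q}. of_nat (?q choose i) * x ^ i * y ^ (?q - i) = 0"
    proof
      fix i assume "i \<in> {..?q} - {0, ?q}"
      hence "0 < i" "i < ?q" by auto
      hence "of_nat (?q choose i) = (0 :: 'b)" by (intro assms finite_field_of_nat_binomial)
      thus "of_nat (?q choose i) * x ^ i * y ^ (?q - i) = 0" by simp
    qed
  qed auto
  also have "\<dots> = x ^ ?q + y ^ ?q" using q1 by (simp add: add.commute)
  finally show ?case by (simp add: power_mult Suc.IH)
qed auto

lemma sum_power_finite_field_card:
  fixes f :: "'c \<Rightarrow> 'b::comm_ring_1"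
  assumes "\<And>n. of_nat n = (0 :: 'a::{field,finite}) \<Longrightarrow> of_nat n = (0 :: 'b)"
  shows "sum f I ^ (card (UNIV :: 'a set) ^ k) = (\<Sum>i\<in>I. f i ^ (card (UNIV :: 'a set) ^ k))"
proof -
  have "card (UNIV :: 'a set) > 0" by (simp add: card_gt_0_iff)
  thus ?thesis
    by (induction I rule: infinite_finite_induct)
       (auto simp: add_power_finite_field_card[where 'a='a, OF assms] power_0_left)
qed

section \<open>Quotient rings\<close>

lemma Quot_nat_pow:
  assumes "ideal I R" "x \<in> carrier R"
  shows "(I +>\<^bsub>R\<^esub> x) [^]\<^bsub>R Quot I\<^esub> (n::nat) = I +>\<^bsub>R\<^esub> (x [^]\<^bsub>R\<^esub> n)"
proof -
  interpret ring_hom_ring R "R Quot I" "(+>\<^bsub>R\<^esub>) I" using assms(1) by (rule ideal.rcos_ring_hom_ring)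
  show ?thesis using hom_nat_pow[OF assms(2)] by simp
qed

lemma carrier_Quot: "carrier (R Quot I) = (\<lambda>x. I +>\<^bsub>R\<^esub> x) ` carrier R"
  by (auto simp: FactRing_def A_RCOSETS_def' a_r_coset_def')

lemma Quot_mult:
  assumes "ideal I R" "x \<in> carrier R" "y \<in> carrier R"
  shows "(I +>\<^bsub>R\<^esub> x) \<otimes>\<^bsub>R Quot I\<^esub> (I +>\<^bsub>R\<^esub> y) = I +>\<^bsub>R\<^esub> (x \<otimes>\<^bsub>R\<^esub> y)"
  using ideal.rcoset_mult_add[OF assms] by (simp add: FactRing_def)

lemma Quot_one: "\<one>\<^bsub>R Quot I\<^esub> = I +>\<^bsub>R\<^esub> \<one>\<^bsub>R\<^esub>"
  by (simp add: FactRing_def)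

lemma Quot_eq_iff:
  assumes "ideal I R" "x \<in> carrier R" "y \<in> carrier R"
  shows "I +>\<^bsub>R\<^esub> x = I +>\<^bsub>R\<^esub> y \<longleftrightarrow> x \<ominus>\<^bsub>R\<^esub> y \<in> I"
proof -
  interpret ideal I R by fact
  show ?thesis using quotient_eq_iff_same_a_r_cos[OF assms] by simp
qed

lemma Quot_eq_zero_iff:
  assumes "ideal I R" "x \<in> carrier R"
  shows "I +>\<^bsub>R\<^esub> x = \<zero>\<^bsub>R Quot I\<^esub> \<longleftrightarrow> x \<in> I"
proof -
  interpret ideal I R by fact
  show ?thesis using assms(2) a_coset_join1[OF _ _ a_subgroup] a_coset_join2[OF _ a_subgroup]
    by (auto simp: FactRing_def)
qed

lemma bij_betw_representatives_Quot:
  assumes I: "ideal I R" and T: "T \<subseteq> carrier R"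
    and ex: "\<And>x. x \<in> carrier R \<Longrightarrow> \<exists>t\<in>T. x \<ominus>\<^bsub>R\<^esub> t \<in> I"
    and uniq: "\<And>s t. s \<in> T \<Longrightarrow> t \<in> T \<Longrightarrow> s \<ominus>\<^bsub>R\<^esub> t \<in> I \<Longrightarrow> s = t"
  shows "bij_betw (\<lambda>x. I +>\<^bsub>R\<^esub> x) T (carrier (R Quot I))"
proof (rule bij_betw_imageI)
  show "inj_on (\<lambda>x. I +>\<^bsub>R\<^esub> x) T"
    using T uniq by (auto simp: inj_on_def subset_iff Quot_eq_iff[OF I])
  show "(\<lambda>x. I +>\<^bsub>R\<^esub> x) ` T = carrier (R Quot I)"
  proof
    show "(\<lambda>x. I +>\<^bsub>R\<^esub> x) ` T \<subseteq> carrier (R Quot I)" using T by (auto simp: carrier_Quot)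
    show "carrier (R Quot I) \<subseteq> (\<lambda>x. I +>\<^bsub>R\<^esub> x) ` T"
    proof
      fix X assume "X \<in> carrier (R Quot I)"
      then obtain x where x: "x \<in> carrier R" "X = I +>\<^bsub>R\<^esub> x" by (auto simp: carrier_Quot)
      then obtain t where "t \<in> T" "x \<ominus>\<^bsub>R\<^esub> t \<in> I" using ex by blast
      with x T have "X = I +>\<^bsub>R\<^esub> t" using Quot_eq_iff[OF I] by blast
      with \<open>t \<in> T\<close> show "X \<in> (\<lambda>x. I +>\<^bsub>R\<^esub> x) ` T" by blast
    qed
  qed
qed

lemma Quot_fieldI:
  assumes R: "cring R" and I: "ideal I R" and one: "\<one>\<^bsub>R\<^esub> \<notin> I"
    and inv: "\<And>x. x \<in> carrier R \<Longrightarrow> x \<notin> I \<Longrightarrow> \<exists>y\<in>carrier R. x \<otimes>\<^bsub>R\<^esub> y \<ominus>\<^bsub>R\<^esub> \<one>\<^bsub>R\<^esub> \<in> I"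
  shows "field (R Quot I)"
proof -
  interpret cring R by fact
  have "cring (R Quot I)" using I R by (simp add: ideal.quotient_is_cring)
  thus ?thesis
  proof (rule cring.cring_fieldI2)
    show "\<zero>\<^bsub>R Quot I\<^esub> \<noteq> \<one>\<^bsub>R Quot I\<^esub>"
      using one Quot_eq_zero_iff[OF I one_closed] by (auto simp: Quot_one)
    fix X assume X: "X \<in> carrier (R Quot I)" "X \<noteq> \<zero>\<^bsub>R Quot I\<^esub>"
    then obtain x where x: "x \<in> carrier R" "X = I +>\<^bsub>R\<^esub> x" by (auto simp: carrier_Quot)
    with X have "x \<notin> I" using Quot_eq_zero_iff[OF I x(1)] by simp
    then obtain y where y: "y \<in> carrier R" "x \<otimes>\<^bsub>R\<^esub> y \<ominus>\<^bsub>R\<^esub> \<one>\<^bsub>R\<^esub> \<in> I" using inv x by blast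
    have "X \<otimes>\<^bsub>R Quot I\<^esub> (I +>\<^bsub>R\<^esub> y) = I +>\<^bsub>R\<^esub> (x \<otimes>\<^bsub>R\<^esub> y)" using x y Quot_mult[OF I] by simp
    also have "\<dots> = \<one>\<^bsub>R Quot I\<^esub>" using x y Quot_eq_iff[OF I] by (simp add: Quot_one)
    finally show "\<exists>Y\<in>carrier (R Quot I). X \<otimes>\<^bsub>R Quot I\<^esub> Y = \<one>\<^bsub>R Quot I\<^esub>"
      using y(1) by (auto simp: carrier_Quot)
  qed
qed

text \<open>A generator of the cyclic unit group, with its order stated as a divisibility criterion.
  It supplies non-residues modulo \<open>p\<close>, and later turns a power identity on O_K/p into a
  divisibility of exponents.\<close>

lemma (in field) finite_field_generator:
  assumes fin: "finite (carrier R)"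
  shows "\<exists>a\<in>carrier R - {\<zero>}. \<forall>n::nat. a [^] n = \<one> \<longleftrightarrow> card (carrier R) - 1 dvd n"
proof -
  interpret G: group "mult_of R" rewrites
      "([^]\<^bsub>mult_of R\<^esub>) = (([^]) :: _ \<Rightarrow> nat \<Rightarrow> _)" and "\<one>\<^bsub>mult_of R\<^esub> = \<one>"
    by (rule field_mult_group) (simp_all add: fun_eq_iff nat_pow_def)
  have fin': "finite (carrier (mult_of R))" using fin by (rule finite_mult_of)
  obtain a where a: "a \<in> carrier (mult_of R)" "carrier (mult_of R) = {a [^] i | i::nat. i \<in> UNIV}"
    using finite_field_mult_group_has_gen[OF fin] by blast
  have ord: "group.ord (mult_of R) a = card (carrier (mult_of R))"
  proof (rule antisym)
    have "carrier (mult_of R) = (\<lambda>i. a [^] i) ` {0..group.ord (mult_of R) a - 1}"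
      using G.ord_elems[OF fin' a(1)] a(2) by auto
    also have "card \<dots> \<le> card {0..group.ord (mult_of R) a - 1}" by (rule card_image_le) simp
    also have "\<dots> = group.ord (mult_of R) a" using G.ord_ge_1[OF fin' a(1)] by simp
    finally show "card (carrier (mult_of R)) \<le> group.ord (mult_of R) a" .
    show "group.ord (mult_of R) a \<le> card (carrier (mult_of R))"
      using G.ord_le_group_order[OF fin' a(1)] by (simp add: Coset.order_def)
  qed
  have "card (carrier (mult_of R)) = card (carrier R) - 1" using order_mult_of[OF fin] by (simp add: Coset.order_def)
  with ord a(1) show ?thesis by (intro bexI[of _ a]) (auto simp: G.pow_eq_id)
qed

lemma (in field) finite_field_pow_card:
  assumes "finite (carrier R)" "a \<in> carrier R"
  shows "a [^] card (carrier R) = a"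
proof (cases "a = \<zero>")
  case True
  have "card (carrier R) \<noteq> 0" using assms by auto
  then obtain k where "card (carrier R) = Suc k" by (cases "card (carrier R)") auto
  then show ?thesis using True by simp
next
  case False
  interpret G: group "mult_of R" rewrites
      "([^]\<^bsub>mult_of R\<^esub>) = (([^]) :: _ \<Rightarrow> nat \<Rightarrow> _)" and "\<one>\<^bsub>mult_of R\<^esub> = \<one>"
    by (rule field_mult_group) (simp_all add: fun_eq_iff nat_pow_def)
  have "a [^] Coset.order (mult_of R) = \<one>" using False assms(2) by (intro G.pow_order_eq_1) auto
  hence "a [^] (card (carrier R) - 1) = \<one>" using order_mult_of[OF assms(1)] by (simp add: Coset.order_def)
  moreover have "card (carrier R) \<noteq> 0" using assms by auto
  then obtain k where "card (carrier R) = Suc k" by (cases "card (carrier R)") auto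
  ultimately show ?thesis using assms(2) by simp
qed

section \<open>Residue rings of $k[t]$\<close>

lemma poly_ring_simps [simp]:
  "carrier poly_ring = UNIV" "x \<otimes>\<^bsub>poly_ring\<^esub> y = x * y" "x \<oplus>\<^bsub>poly_ring\<^esub> y = x + y"
  "\<one>\<^bsub>poly_ring\<^esub> = 1" "\<zero>\<^bsub>poly_ring\<^esub> = 0"
  by (simp_all add: poly_ring_def)

lemma cring_poly_ring: "cring (poly_ring :: 'a::field poly ring)"
proof (rule cringI)
  show "abelian_group (poly_ring :: 'a poly ring)"
  proof (rule abelian_groupI)
    fix x :: "'a poly"
    show "\<exists>y\<in>carrier poly_ring. y \<oplus>\<^bsub>poly_ring\<^esub> x = \<zero>\<^bsub>poly_ring\<^esub>"
      by (rule bexI[of _ "- x"]) auto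
  qed (auto simp: algebra_simps)
  show "Group.comm_monoid (poly_ring :: 'a poly ring)" by (rule comm_monoidI) (auto simp: algebra_simps)
qed (auto simp: algebra_simps)

lemma poly_ring_minus [simp]: "x \<ominus>\<^bsub>poly_ring\<^esub> y = x - y"
proof -
  interpret cring poly_ring by (rule cring_poly_ring)
  have "\<ominus>\<^bsub>poly_ring\<^esub> y = - y" by (rule minus_equality) auto
  thus ?thesis by (simp add: a_minus_def)
qed

lemma poly_ring_pow [simp]: "x [^]\<^bsub>poly_ring\<^esub> (n::nat) = x ^ n"
  by (induction n) (simp_all add: nat_pow_def poly_ring_def mult.commute)

lemma mem_PIdl_poly_ring: "x \<in> PIdl\<^bsub>poly_ring\<^esub> g \<longleftrightarrow> g dvd x"
  by (auto simp: cgenideal_def dvd_def mult.commute)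

lemma ideal_PIdl_poly_ring: "ideal (PIdl\<^bsub>poly_ring\<^esub> g) poly_ring"
  by (rule cring.cgenideal_ideal[OF cring_poly_ring]) simp

text \<open>The coefficient set is arbitrary so that the count can be iterated: \<open>C\<close> =
  F_q counts residues of A, and then \<open>C\<close> = reduced residues of A counts residues of
  A[X].\<close>

lemma finite_card_bounded_coeffs:
  fixes C :: "'b::zero set"
  assumes "finite C" "0 \<in> C"
  shows "finite {f. (\<forall>i. coeff f i \<in> C) \<and> (\<forall>i\<ge>n. coeff f i = 0)} \<and>
    card {f. (\<forall>i. coeff f i \<in> C) \<and> (\<forall>i\<ge>n. coeff f i = 0)} = card C ^ n"
proof (induction n)
  case 0
  have "{f. (\<forall>i. coeff f i \<in> C) \<and> (\<forall>i\<ge>0. coeff f i = 0)} = {0}"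
    using assms(2) by (auto simp: poly_eq_iff)
  then show ?case by simp
next
  case (Suc n)
  let ?S = "\<lambda>n. {f. (\<forall>i. coeff f i \<in> C) \<and> (\<forall>i\<ge>n. coeff f i = 0)}"
  have "?S (Suc n) = (\<lambda>(c, f). pCons c f) ` (C \<times> ?S n)"
  proof (intro equalityI subsetI)
    fix f assume f: "f \<in> ?S (Suc n)"
    obtain c f' where "f = pCons c f'" by (cases f)
    moreover have "c \<in> C" using f \<open>f = pCons c f'\<close> by (auto dest: spec[of _ 0])
    moreover have "coeff f' i = coeff f (Suc i)" for i using \<open>f = pCons c f'\<close> by simp
    hence "f' \<in> ?S n" using f by auto
    ultimately show "f \<in> (\<lambda>(c, f). pCons c f) ` (C \<times> ?S n)" by auto
  next
    fix f assume "f \<in> (\<lambda>(c, f). pCons c f) ` (C \<times> ?S n)"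
    thus "f \<in> ?S (Suc n)" using assms(2) by (auto simp: coeff_pCons split: nat.splits)
  qed
  moreover have "inj_on (\<lambda>(c, f). pCons c f) (C \<times> ?S n)" by (auto simp: inj_on_def)
  ultimately show ?case using Suc assms(1) by (simp add: card_image card_cartesian_product)
qed

lemma card_degree_less:
  assumes "n > 0"
  shows "card {f :: 'a::{zero,finite} poly. degree f < n} = card (UNIV :: 'a set) ^ n"
    "finite {f :: 'a::{zero,finite} poly. degree f < n}"
proof -
  have "degree f < n \<longleftrightarrow> (\<forall>i\<ge>n. coeff f i = 0)" for f :: "'a poly"
    using assms degree_lessI[of f n] by (auto simp: coeff_eq_0)
  thus "card {f :: 'a::{zero,finite} poly. degree f < n} = card (UNIV :: 'a set) ^ n"
    "finite {f :: 'a::{zero,finite} poly. degree f < n}"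
    using finite_card_bounded_coeffs[of "UNIV :: 'a set" n] by auto
qed

lemma card_poly_ring_Quot:
  fixes g :: "'a::{field,finite} poly"
  assumes "degree g > 0"
  shows "card (carrier (poly_ring Quot PIdl\<^bsub>poly_ring\<^esub> g)) = card (UNIV :: 'a set) ^ degree g"
    "finite (carrier (poly_ring Quot PIdl\<^bsub>poly_ring\<^esub> g))"
proof -
  let ?I = "PIdl\<^bsub>poly_ring\<^esub> g" and ?T = "{f. degree f < degree g}"
  have bij: "bij_betw (\<lambda>x. ?I +>\<^bsub>poly_ring\<^esub> x) ?T (carrier (poly_ring Quot ?I))"
  proof (rule bij_betw_representatives_Quot[OF ideal_PIdl_poly_ring])
    fix x
    have "x mod g \<in> ?T" using assms degree_mod_less[of g x] by (cases "g = 0") auto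
    thus "\<exists>t\<in>?T. x \<ominus>\<^bsub>poly_ring\<^esub> t \<in> ?I"
      by (intro bexI[of _ "x mod g"]) (auto simp: mem_PIdl_poly_ring dvd_minus_mod)
  next
    fix s t assume "s \<in> ?T" "t \<in> ?T" "s \<ominus>\<^bsub>poly_ring\<^esub> t \<in> ?I"
    moreover from this have "degree (s - t) < degree g" by (auto intro: degree_diff_less)
    ultimately show "s = t" using dvd_imp_degree_le[of g "s - t"] by (auto simp: mem_PIdl_poly_ring)
  qed auto
  show "card (carrier (poly_ring Quot ?I)) = card (UNIV :: 'a set) ^ degree g"
    "finite (carrier (poly_ring Quot ?I))"
    using bij_betw_same_card[OF bij] bij_betw_finite[OF bij] card_degree_less[OF assms, where 'a='a] by auto
qed

lemma field_poly_ring_Quot: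
  fixes p :: "'a::field poly"
  assumes "irreducible p"
  shows "field (poly_ring Quot PIdl\<^bsub>poly_ring\<^esub> p)"
proof (rule Quot_fieldI[OF cring_poly_ring ideal_PIdl_poly_ring])
  show "\<one>\<^bsub>poly_ring\<^esub> \<notin> PIdl\<^bsub>poly_ring\<^esub> p" using assms by (auto simp: mem_PIdl_poly_ring irreducible_def)
  fix x assume "x \<notin> PIdl\<^bsub>poly_ring\<^esub> p"
  then obtain u v where "u * p + v * x = 1"
    using field_poly_irreducible_bezout[OF assms, of x] by (auto simp: mem_PIdl_poly_ring)
  hence "x * v - 1 = p * (- u)" by (simp add: algebra_simps)
  thus "\<exists>y\<in>carrier poly_ring. x \<otimes>\<^bsub>poly_ring\<^esub> y \<ominus>\<^bsub>poly_ring\<^esub> \<one>\<^bsub>poly_ring\<^esub> \<in> PIdl\<^bsub>poly_ring\<^esub> p"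
    by (intro bexI[of _ v]) (auto simp: mem_PIdl_poly_ring)
qed

text \<open>The residue ring modulo \<open>p\<close> is a field with \<open>q ^ degree p\<close>
  elements.\<close>

lemma poly_fermat:
  fixes p c :: "'a::{field,finite} poly"
  assumes "irreducible p"
  shows "p dvd c ^ (card (UNIV :: 'a set) ^ degree p) - c"
proof -
  let ?I = "PIdl\<^bsub>poly_ring\<^esub> p"
  note I = ideal_PIdl_poly_ring[of p]
  interpret field "poly_ring Quot ?I" using assms by (rule field_poly_ring_Quot)
  note card = card_poly_ring_Quot[OF irreducible_degree_pos[OF assms]]
  have "?I +>\<^bsub>poly_ring\<^esub> c \<in> carrier (poly_ring Quot ?I)" by (simp add: carrier_Quot)
  from finite_field_pow_card[OF card(2) this]
  have "?I +>\<^bsub>poly_ring\<^esub> (c ^ (card (UNIV :: 'a set) ^ degree p)) = ?I +>\<^bsub>poly_ring\<^esub> c"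
    by (simp add: Quot_nat_pow[OF I] card(1))
  thus ?thesis by (simp add: Quot_eq_iff[OF I] mem_PIdl_poly_ring)
qed

text \<open>A generator of the unit group works: its order \<open>Q - 1\<close>, with
  \<open>Q = q ^ degree p\<close>, cannot divide the smaller positive number
  \<open>(Q - 1)/l\<close>. Non-residues are expressed by Euler's criterion because this power is
  the one that occurs as an eigenvalue.\<close>

lemma power_nonresidue_exists:
  fixes p :: "'a::{field,finite} poly"
  assumes "irreducible p" "prime l" "l dvd card (UNIV :: 'a set) ^ degree p - 1"
  shows "\<exists>n. \<not> p dvd n \<and> \<not> p dvd n ^ ((card (UNIV :: 'a set) ^ degree p - 1) div l) - 1"
proof -
  let ?I = "PIdl\<^bsub>poly_ring\<^esub> p" and ?Q = "card (UNIV :: 'a set) ^ degree p"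
  note I = ideal_PIdl_poly_ring[of p]
  interpret field "poly_ring Quot ?I" using assms(1) by (rule field_poly_ring_Quot)
  note card = card_poly_ring_Quot[OF irreducible_degree_pos[OF assms(1)]]
  obtain a where a: "a \<in> carrier (poly_ring Quot ?I)" "a \<noteq> \<zero>\<^bsub>poly_ring Quot ?I\<^esub>"
    "\<And>n::nat. a [^]\<^bsub>poly_ring Quot ?I\<^esub> n = \<one>\<^bsub>poly_ring Quot ?I\<^esub> \<longleftrightarrow> ?Q - 1 dvd n"
    using finite_field_generator[OF card(2)] by (auto simp: card(1))
  obtain n where n: "a = ?I +>\<^bsub>poly_ring\<^esub> n" using a(1) by (auto simp: carrier_Quot)
  have "\<not> p dvd n" using a(2) unfolding n by (simp add: Quot_eq_zero_iff[OF I] mem_PIdl_poly_ring)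
  moreover have "\<not> p dvd n ^ ((?Q - 1) div l) - 1"
  proof
    assume "p dvd n ^ ((?Q - 1) div l) - 1"
    hence "a [^]\<^bsub>poly_ring Quot ?I\<^esub> ((?Q - 1) div l) = \<one>\<^bsub>poly_ring Quot ?I\<^esub>"
      unfolding n by (simp add: Quot_nat_pow[OF I] Quot_one Quot_eq_iff[OF I] mem_PIdl_poly_ring)
    hence dvd: "?Q - 1 dvd (?Q - 1) div l" using a(3) by simp
    have "card (UNIV :: 'a set) > 1" using card_mono[of "UNIV :: 'a set" "{0, 1}"] by simp
    hence "?Q > 1" using irreducible_degree_pos[OF assms(1)] by (rule one_less_power)
    hence *: "?Q - 1 > 0" by simp
    hence "(?Q - 1) div l > 0" using assms(3) prime_gt_0_nat[OF assms(2)]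
      by (meson div_greater_zero_iff dvd_imp_le)
    with dvd have "?Q - 1 \<le> (?Q - 1) div l" by (rule dvd_imp_le)
    moreover have "(?Q - 1) div l < ?Q - 1" using * prime_gt_1_nat[OF assms(2)] by (rule div_less_dividend[rotated])
    ultimately show False by simp
  qed
  ultimately show ?thesis by blast
qed

lemma squarefree_dvdI:
  fixes g a :: "'a::field poly"
  assumes "squarefree g" "g \<noteq> 0" "\<And>p. irreducible p \<Longrightarrow> p dvd g \<Longrightarrow> p dvd a"
  shows "g dvd a"
  using assms
proof (induction "degree g" arbitrary: g rule: less_induct)
  case less
  show ?case
  proof (cases "degree g = 0")
    case True
    thus ?thesis using less.prems(2) by (meson is_unit_iff_degree unit_imp_dvd)
  next
    case False
    then obtain p where p: "irreducible p" "p dvd g" using irreducible_dvd_field_poly_exists by blast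
    then obtain g' where g': "g = p * g'" by (auto elim: dvdE)
    hence 0: "g' \<noteq> 0" using less.prems by auto
    have "degree g' < degree g"
      using g' less.prems(2) irreducible_degree_pos[OF p(1)] by (auto simp: degree_mult_eq)
    moreover have "squarefree g'" using less.prems(1) g' by (metis dvd_triv_right squarefree_mono)
    moreover have "r dvd a" if "irreducible r" "r dvd g'" for r
      using that less.prems(3) g' by (metis dvd_mult)
    ultimately have "g' dvd a" using 0 less.hyps[of g'] by blast
    then obtain b where b: "a = g' * b" by (auto elim: dvdE)
    have "\<not> p dvd g'"
    proof
      assume "p dvd g'"
      hence "p ^ 2 dvd g" using g' by (simp add: power2_eq_square mult_dvd_mono)
      hence "p dvd 1" using less.prems(1) by (simp add: squarefreeD)
      thus False using p(1) by (auto simp: irreducible_def)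
    qed
    moreover have "p dvd g' * b" using less.prems(3) p b by blast
    ultimately have "p dvd b"
      using field_poly_irreducible_imp_prime[OF p(1)] by (meson prime_elem_dvd_multD)
    thus ?thesis using g' b by (simp add: mult.commute mult_dvd_mono)
  qed
qed

text \<open>Modulo each prime \<open>p\<close> of \<open>g\<close> the
  \<open>q ^ degree g\<close>-power map is an iterate of the \<open>q ^ degree p\<close>-power map,
  hence the identity; squarefreeness combines the primes. A proper factorization of \<open>g\<close>
  yields zero divisors. Used in contraposition, it produces the prime to be made inert.\<close>

lemma korselt_carmichael_poly:
  fixes g :: "'a::{field,finite} poly"
  assumes g: "degree g > 0" "squarefree g" "\<not> irreducible g"
    and deg: "\<And>p. irreducible p \<Longrightarrow> p dvd g \<Longrightarrow> degree p dvd degree g"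
  shows "carmichael_poly g"
proof -
  let ?I = "PIdl\<^bsub>poly_ring\<^esub> g" and ?q = "card (UNIV :: 'a set)"
  note I = ideal_PIdl_poly_ring[of g]
  note card = card_poly_ring_Quot[OF g(1)]
  have "g \<noteq> 0" using g(1) by auto
  hence "\<not> g dvd 1" using g(1) by (simp add: is_unit_iff_degree)
  with g(3) \<open>g \<noteq> 0\<close> obtain b c where bc: "g = b * c" "\<not> b dvd 1" "\<not> c dvd 1"
    by (auto simp: irreducible_def)
  with \<open>g \<noteq> 0\<close> have 0: "b \<noteq> 0" "c \<noteq> 0" by auto
  hence "degree b > 0" "degree c > 0" using bc(2,3) by (simp_all add: is_unit_iff_degree)
  hence "degree b < degree g" "degree c < degree g" using bc 0 by (simp_all add: degree_mult_eq)
  hence ndvd: "\<not> g dvd b" "\<not> g dvd c" using 0 dvd_imp_degree_le[of g b] dvd_imp_degree_le[of g c] by auto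
  have "\<not> field (poly_ring Quot ?I)"
  proof
    assume "field (poly_ring Quot ?I)"
    then interpret field "poly_ring Quot ?I" .
    have "?I +>\<^bsub>poly_ring\<^esub> b \<noteq> \<zero>\<^bsub>poly_ring Quot ?I\<^esub>" "?I +>\<^bsub>poly_ring\<^esub> c \<noteq> \<zero>\<^bsub>poly_ring Quot ?I\<^esub>"
      using ndvd by (simp_all add: Quot_eq_zero_iff[OF I] mem_PIdl_poly_ring)
    moreover have "(?I +>\<^bsub>poly_ring\<^esub> b) \<otimes>\<^bsub>poly_ring Quot ?I\<^esub> (?I +>\<^bsub>poly_ring\<^esub> c) = \<zero>\<^bsub>poly_ring Quot ?I\<^esub>"
      by (simp add: Quot_mult[OF I] Quot_eq_zero_iff[OF I] mem_PIdl_poly_ring bc(1)[symmetric])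
    ultimately show False using integral[of "?I +>\<^bsub>poly_ring\<^esub> b" "?I +>\<^bsub>poly_ring\<^esub> c"] by (auto simp: carrier_Quot)
  qed
  moreover have "a [^]\<^bsub>poly_ring Quot ?I\<^esub> card (carrier (poly_ring Quot ?I)) = a"
    if a: "a \<in> carrier (poly_ring Quot ?I)" for a
  proof -
    from a obtain x where x: "a = ?I +>\<^bsub>poly_ring\<^esub> x" by (auto simp: carrier_Quot)
    have "g dvd x ^ (?q ^ degree g) - x"
    proof (rule squarefree_dvdI)
      fix p assume p: "irreducible p" "p dvd g"
      obtain k where k: "degree g = degree p * k" using deg[OF p] by (auto elim: dvdE)
      have "p dvd x ^ (?q ^ (degree p * k)) - x"
      proof (induction k)
        case (Suc k)
        let ?y = "x ^ (?q ^ (degree p * k))"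
        have "p dvd (?y ^ (?q ^ degree p) - ?y) + (?y - x)"
          using poly_fermat[OF p(1)] Suc by (rule dvd_add)
        also have "?y ^ (?q ^ degree p) = x ^ (?q ^ (degree p * Suc k))"
          by (simp add: power_add mult.commute flip: power_mult)
        finally show ?case by simp
      qed auto
      thus "p dvd x ^ (?q ^ degree g) - x" using k by simp
    qed (use g in auto)
    thus ?thesis unfolding x by (simp add: card(1) Quot_nat_pow[OF I] Quot_eq_iff[OF I] mem_PIdl_poly_ring)
  qed
  ultimately show ?thesis
    using card(2) by (simp add: carmichael_poly_def carmichael_ideal_def carmichael_ring_def)
qed

lemma minus_one_dvd_power_minus_one:
  fixes q k :: nat
  assumes "q > 0"
  shows "q - 1 dvd q ^ k - 1"
proof (induction k)
  case (Suc k)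
  have "q ^ Suc k - 1 = q * (q ^ k - 1) + (q - 1)"
    using assms by (simp add: diff_mult_distrib2)
  thus ?case using Suc by (metis dvd_add dvd_mult dvd_refl)
qed simp

text \<open>Euclid's algorithm on the exponents: \<open>q^b - 1\<close> and
  \<open>q^(b-a) - 1\<close> agree modulo \<open>q^a - 1\<close>. The descent ends at
  \<open>b < a\<close>, where size forces \<open>b = 0\<close>; for \<open>a = 0\<close> the divisor
  is 0, with the same effect.\<close>

lemma power_minus_one_dvd_power_minus_one:
  fixes q a b :: nat
  assumes "q > 1" "q ^ a - 1 dvd q ^ b - 1"
  shows "a dvd b"
  using assms(2)
proof (induction b rule: less_induct)
  case (less b)
  show ?case
  proof (cases "b < a \<or> a = 0")
    case True
    show ?thesis
    proof (cases "b = 0")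
      case False
      have "q ^ b - 1 > 0" using False one_less_power[OF assms(1), of b] by simp
      with less.prems have "q ^ a - 1 \<le> q ^ b - 1" by (simp add: dvd_imp_le)
      moreover have "a \<noteq> 0" using less.prems \<open>q ^ b - 1 > 0\<close> by (cases "a = 0") auto
      moreover from this True assms(1) have "q ^ b < q ^ a" by simp
      ultimately show ?thesis using \<open>q ^ b - 1 > 0\<close> by linarith
    qed auto
  next
    case False
    have "q ^ b - 1 = q ^ (b - a) * (q ^ a - 1) + (q ^ (b - a) - 1)"
    proof -
      have "q ^ b = q ^ (b - a) * q ^ a" using False by (simp flip: power_add)
      moreover have "q ^ (b - a) \<ge> 1" "q ^ b \<ge> q ^ (b - a)" using assms(1) by (auto intro: power_increasing)
      ultimately show ?thesis by (simp add: diff_mult_distrib2)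
    qed
    with less.prems have "q ^ a - 1 dvd q ^ (b - a) - 1" by (simp add: dvd_add_right_iff)
    hence "a dvd b - a" using False by (intro less.IH) auto
    thus ?thesis using False by (simp add: dvd_minus_self)
  qed
qed

section \<open>Kummer extensions\<close>

definition kummer_poly :: "nat \<Rightarrow> 'a::field poly \<Rightarrow> 'a poly fract poly" where
  "kummer_poly l m = monom 1 l - [:to_fract m:]"

text \<open>This is A[X] kept inside the polynomials over F_q(t), so that it can be mixed with
  reduction modulo \<open>h\<close>. Its members of degree below \<open>l\<close> represent the
  order A[X]/(X^l - m).\<close>

definition integral_polys :: "'a::field poly fract poly set" where
  "integral_polys = {s. \<forall>i. coeff s i \<in> range to_fract}"

lemma integral_polysD: "s \<in> integral_polys \<Longrightarrow> coeff s i \<in> range to_fract"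
  by (simp add: integral_polys_def)

lemma integral_polys_closed:
  assumes "s \<in> integral_polys" "t \<in> integral_polys"
  shows "s + t \<in> integral_polys" "s - t \<in> integral_polys" "s * t \<in> integral_polys"
  using assms
  by (auto simp: integral_polys_def coeff_mult simp del: to_fract_add to_fract_mult
      intro!: range_to_fract_closed range_to_fract_sum)

lemma integral_polys_uminus: "s \<in> integral_polys \<Longrightarrow> - s \<in> integral_polys"
  by (simp add: integral_polys_def range_to_fract_uminus)

lemma integral_polys_const [simp, intro]: "[:to_fract a:] \<in> integral_polys"
  and integral_polys_monom [simp, intro]: "monom (to_fract a) i \<in> integral_polys"
  and integral_polys_0 [simp, intro]: "0 \<in> integral_polys"
  and integral_polys_1 [simp, intro]: "1 \<in> integral_polys"
  by (auto simp: integral_polys_def coeff_pCons split: nat.splits)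

lemma integral_polys_power: "s \<in> integral_polys \<Longrightarrow> s ^ n \<in> integral_polys"
  by (induction n) (auto intro: integral_polys_closed)

lemma integral_polys_sum:
  "(\<And>i. i \<in> I \<Longrightarrow> f i \<in> integral_polys) \<Longrightarrow> sum f I \<in> integral_polys"
  by (induction I rule: infinite_finite_induct) (auto intro: integral_polys_closed)

lemma integral_polys_of_nat [simp, intro]: "of_nat n \<in> integral_polys"
  by (induction n) (auto intro: integral_polys_closed)

lemma common_denominator:
  fixes s :: "'a::field poly fract poly"
  shows "\<exists>d. d \<noteq> 0 \<and> [:to_fract d:] * s \<in> integral_polys"
proof (induction s)
  case 0
  show ?case by (intro exI[of _ 1]) simp
next
  case (pCons c s)
  then obtain d where d: "d \<noteq> 0" "[:to_fract d:] * s \<in> integral_polys" by blast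
  obtain a b where ab: "c = to_fract a / to_fract b" "b \<noteq> 0" by (rule fract_eq_quotient)
  have "[:to_fract (b * d):] * pCons c s = pCons (to_fract (d * a)) ([:to_fract b:] * ([:to_fract d:] * s))"
    using ab by (simp add: field_simps)
  also have "\<dots> \<in> integral_polys"
    using integral_polys_closed(3)[OF integral_polys_const d(2), of b]
    by (auto simp: integral_polys_def coeff_pCons simp del: to_fract_mult split: nat.splits)
  finally show ?case using ab(2) d(1) by (intro exI[of _ "b * d"]) auto
qed

lemma poly_mod_sum:
  fixes h :: "'b::field poly"
  shows "sum f I mod h = (\<Sum>i\<in>I. f i mod h)"
  by (induction I rule: infinite_finite_induct) (auto simp: poly_mod_add_left)

lemma poly_eq_sum_monom:
  assumes "degree s < n"
  shows "s = (\<Sum>i<n. monom (coeff s i) i)"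
proof (rule poly_eqI)
  fix j
  show "coeff s j = coeff (\<Sum>i<n. monom (coeff s i) i) j"
    using assms by (cases "j < n") (auto simp: coeff_sum coeff_eq_0)
qed

lemma of_nat_poly_fract_poly:
  assumes "of_nat n = (0 :: 'a::{field,finite})"
  shows "of_nat n = (0 :: 'a poly fract poly)"
  using assms by (simp add: of_nat_poly flip: to_fract_of_nat)

text \<open>Integrality is analysed here in the algebra F_q(t)[X]/(X^l - m); irreducibility of
  \<open>h\<close> is derived afterwards from an inert prime, in
  \<open>kummer_inert\<close>.\<close>

locale kummer =
  fixes m :: "'a::{field,finite} poly" and l q :: nat
  assumes q_eq: "q = card (UNIV :: 'a set)"
    and prime_l: "prime l" and l_dvd: "l dvd q - 1" and m_nz: "m \<noteq> 0"
begin

abbreviation "M \<equiv> to_fract m"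
abbreviation "h \<equiv> kummer_poly l m"

lemma l_gt_1: "l > 1" and l_gt_0 [simp]: "l > 0" and l_nz [simp]: "l \<noteq> 0"
  using prime_gt_1_nat[OF prime_l] by auto

lemma q_gt_1: "q > 1"
  using card_mono[of "UNIV :: 'a set" "{0, 1}"] by (simp add: q_eq)

lemma degree_h [simp]: "degree h = l"
proof -
  have "degree (monom 1 l + (- [:to_fract m:]) :: 'a poly fract poly) = degree (monom 1 l :: 'a poly fract poly)"
    by (rule degree_add_eq_left) (simp add: degree_monom_eq)
  thus ?thesis by (simp only: kummer_poly_def diff_conv_add_uminus degree_monom_eq one_neq_zero simp_thms)
qed

lemma h_nz [simp]: "h \<noteq> 0"
  using degree_h l_nz by (metis degree_0)

lemma mod_h_degree [simp]: "degree (s mod h) < l"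
  using degree_mod_less'[of h s] by (cases "s mod h = 0") auto

lemma mod_h_id: "degree s < l \<Longrightarrow> s mod h = s"
  by (simp add: mod_poly_less)

lemma cong_imp_eq: "[s = t] (mod h) \<Longrightarrow> degree s < l \<Longrightarrow> degree t < l \<Longrightarrow> s = t"
  by (simp add: cong_def mod_h_id)

lemma cong_mod_h [simp]: "[s mod h = s] (mod h)"
  by (simp add: cong_def)

lemma monom_cong: "[monom c k = monom (c * M ^ (k div l)) (k mod l)] (mod h)"
proof -
  have "monom 1 l - [:M:] = h" by (simp add: kummer_poly_def)
  hence "[monom 1 l = [:M:]] (mod h)" by (metis cong_iff_dvd_diff dvd_refl)
  hence "[monom 1 l ^ (k div l) * monom c (k mod l) = [:M:] ^ (k div l) * monom c (k mod l)] (mod h)"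
    by (intro cong_mult cong_pow) auto
  moreover have "monom 1 l ^ (k div l) * monom c (k mod l) = monom c k"
    by (simp add: monom_power mult_monom)
  moreover have "[:M:] ^ (k div l) * monom c (k mod l) = monom (c * M ^ (k div l)) (k mod l)"
    by (simp add: mult_monom monom_power mult.commute flip: monom_0)
  ultimately show ?thesis by simp
qed

lemma monom_mod_h: "monom c k mod h = monom (c * M ^ (k div l)) (k mod l)"
proof -
  have "degree (monom (c * M ^ (k div l)) (k mod l)) < l"
    by (rule le_less_trans[OF degree_monom_le]) simp
  thus ?thesis using monom_cong[of c k] by (simp add: cong_def mod_h_id)
qed

lemma integral_polys_mod:
  assumes "s \<in> integral_polys"
  shows "s mod h \<in> integral_polys"
proof -
  have "s = (\<Sum>i<Suc (degree s). monom (coeff s i) i)" by (rule poly_eq_sum_monom) simp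
  hence "s mod h = (\<Sum>i<Suc (degree s). monom (coeff s i * M ^ (i div l)) (i mod l))"
    by (metis (no_types, lifting) monom_mod_h poly_mod_sum sum.cong)
  also have "\<dots> \<in> integral_polys"
  proof (rule integral_polys_sum)
    fix i
    obtain a where "coeff s i = to_fract a" using integral_polysD[OF assms, of i] by blast
    hence "coeff s i * M ^ (i div l) = to_fract (a * m ^ (i div l))" by simp
    thus "monom (coeff s i * M ^ (i div l)) (i mod l) \<in> integral_polys"
      by (simp only: integral_polys_monom)
  qed
  finally show ?thesis .
qed

lemma l_dvd_power: "l dvd q ^ k - 1"
  using l_dvd minus_one_dvd_power_minus_one[of q k] q_gt_1 by (meson dvd_trans zero_less_one less_trans)

text \<open>The number of factors \<open>m\<close> split off when \<open>X^(q^k)\<close> is reduced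
  modulo \<open>h\<close>: since \<open>q^k = 1 + l * frob_exp k\<close>, the remainder is
  \<open>m^(frob_exp k) X\<close>.\<close>

definition frob_exp :: "nat \<Rightarrow> nat" where "frob_exp k = (q ^ k - 1) div l"

lemma q_power_eq: "q ^ k = l * frob_exp k + 1"
  using l_dvd_power[of k] q_gt_1 by (simp add: frob_exp_def)

text \<open>Growth of the exponents is what makes \<open>integral_of_bounded_denominators\<close>
  applicable.\<close>

lemma frob_exp_ge: "frob_exp k \<ge> k"
proof (induction k)
  case (Suc k)
  have "l * frob_exp (Suc k) + 1 = q * (l * frob_exp k + 1)"
    using q_power_eq[of "Suc k"] q_power_eq[of k] by simp
  hence *: "l * frob_exp (Suc k) + 1 = q * l * frob_exp k + q" by (simp add: algebra_simps)
  have "q * l * frob_exp k \<ge> l * frob_exp k" using q_gt_1 by simp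
  with * q_gt_1 have "l * frob_exp (Suc k) > l * frob_exp k" by linarith
  hence "frob_exp (Suc k) > frob_exp k" by simp
  with Suc show ?case by simp
qed simp

text \<open>The $q^k$-power map acts diagonally on the basis $1, X, \dots, X^{l-1}$,
  because $q \equiv 1$ modulo $l$.\<close>
lemma frobenius_monom:
  assumes "i < l"
  shows "[monom c i ^ (q ^ k) = monom (c ^ (q ^ k) * M ^ (i * frob_exp k)) i] (mod h)"
proof -
  have "i * q ^ k = i + l * (i * frob_exp k)" by (simp add: q_power_eq algebra_simps)
  hence "i * q ^ k div l = i * frob_exp k" "i * q ^ k mod l = i" using assms by simp_all
  thus ?thesis using monom_cong[of "c ^ (q ^ k)" "i * q ^ k"] by (simp add: monom_power)
qed

text \<open>Additivity of the \<open>q ^ k\<close>-power map removes all mixed terms, so each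
  coefficient of the power depends on the same coefficient of \<open>s\<close> only. Coefficients
  can thus be treated one at a time.\<close>

lemma frobenius_coeff:
  assumes "degree s < l" "i < l"
  shows "coeff (s ^ (q ^ k) mod h) i = coeff s i ^ (q ^ k) * M ^ (i * frob_exp k)"
proof -
  have "s ^ (q ^ k) = (\<Sum>i<l. monom (coeff s i) i) ^ (q ^ k)" using poly_eq_sum_monom[OF assms(1)] by simp
  also have "\<dots> = (\<Sum>i<l. monom (coeff s i) i ^ (q ^ k))"
    unfolding q_eq by (rule sum_power_finite_field_card[where 'a='a, OF of_nat_poly_fract_poly])
  also have "[\<dots> = (\<Sum>i<l. monom (coeff s i ^ (q ^ k) * M ^ (i * frob_exp k)) i)] (mod h)"
    by (rule cong_sum) (simp add: frobenius_monom)
  finally have "s ^ (q ^ k) mod h = (\<Sum>i<l. monom (coeff s i ^ (q ^ k) * M ^ (i * frob_exp k)) i) mod h"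
    by (simp add: cong_def)
  also have "\<dots> = (\<Sum>i<l. monom (coeff s i ^ (q ^ k) * M ^ (i * frob_exp k)) i)"
    by (intro mod_h_id degree_sum_less) (auto intro: le_less_trans[OF degree_monom_le])
  finally show ?thesis using assms(2) by (simp add: coeff_sum)
qed

end

section \<open>Integrality over A in terms of coefficients\<close>

definition int_eval :: "'a::field poly poly \<Rightarrow> 'a poly fract poly \<Rightarrow> 'a poly fract poly" where
  "int_eval p x = poly (map_poly (\<lambda>a. [:to_fract a:]) p) x"

lemma int_eval_0 [simp]: "int_eval 0 x = 0"
  by (simp add: int_eval_def)

lemma int_eval_pCons [simp]: "int_eval (pCons a p) x = [:to_fract a:] + x * int_eval p x"
  by (simp add: int_eval_def map_poly_pCons)

lemma int_eval_1 [simp]: "int_eval 1 x = 1"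
  using int_eval_pCons[of 1 0 x] by (simp flip: one_pCons)

lemma int_eval_add: "int_eval (p + r) x = int_eval p x + int_eval r x"
proof (induction p arbitrary: r)
  case (pCons a p)
  obtain b r' where r: "r = pCons b r'" by (cases r)
  have "int_eval (pCons a p + r) x = ([:to_fract a:] + [:to_fract b:]) + x * (int_eval p x + int_eval r' x)"
    by (simp add: r pCons.IH)
  thus ?case by (simp only: r int_eval_pCons distrib_left add_ac)
qed simp

lemma int_eval_smult: "int_eval (smult c p) x = [:to_fract c:] * int_eval p x"
  by (induction p) (simp_all add: algebra_simps)

lemma int_eval_diff: "int_eval (p - r) x = int_eval p x - int_eval r x"
proof -
  have "int_eval p x = int_eval (p - r) x + int_eval r x" by (simp flip: int_eval_add)
  thus ?thesis by simp
qed

lemma int_eval_mult: "int_eval (p * r) x = int_eval p x * int_eval r x"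
  by (induction p) (simp_all add: int_eval_add int_eval_smult algebra_simps)

lemma int_eval_power: "int_eval (p ^ n) x = int_eval p x ^ n"
  by (induction n) (simp_all add: int_eval_mult)

lemma int_eval_altdef: "int_eval p x = (\<Sum>i\<le>degree p. [:to_fract (coeff p i):] * x ^ i)"
proof -
  have *: "coeff (map_poly (\<lambda>a. [:to_fract a:]) p) i = [:to_fract (coeff p i):]" for i
    by (simp add: coeff_map_poly)
  have "degree (map_poly (\<lambda>a. [:to_fract a:]) p) = degree p"
    by (cases "p = 0") (auto intro: map_poly_degree_eq)
  thus ?thesis by (simp add: int_eval_def poly_altdef *)
qed

context kummer
begin

lemma mem_OK_iff: "x \<in> OK h \<longleftrightarrow> degree x < l \<and> (\<exists>p. lead_coeff p = 1 \<and> [int_eval p x = 0] (mod h))"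
  by (simp add: OK_def Kset_def int_eval_def cong_def to_fract_def)

text \<open>Complete integrality. Unlike an integral equation, it passes to sums and products by
  multiplying the denominators.\<close>

definition bounded_denom :: "'a poly fract poly \<Rightarrow> bool" where
  "bounded_denom x \<longleftrightarrow> (\<exists>d. d \<noteq> 0 \<and> (\<forall>n. ([:to_fract d:] * x ^ n) mod h \<in> integral_polys))"

text \<open>Choose \<open>d\<close> to clear the denominators of the powers of \<open>x\<close>
  below the degree of the equation; the equation then expresses all higher powers through these with
  coefficients in A.\<close>

lemma bounded_denom_if_integral:
  assumes p: "lead_coeff p = 1" "[int_eval p x = 0] (mod h)"
  shows "bounded_denom x"
proof -
  let ?n = "degree p"
  have "\<exists>d. d \<noteq> 0 \<and> (\<forall>k<n. [:to_fract d:] * x ^ k \<in> integral_polys)" for n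
  proof (induction n)
    case (Suc n)
    then obtain d where d: "d \<noteq> 0" "\<And>k. k < n \<Longrightarrow> [:to_fract d:] * x ^ k \<in> integral_polys" by blast
    obtain e where e: "e \<noteq> 0" "[:to_fract e:] * x ^ n \<in> integral_polys"
      using common_denominator by blast
    have "[:to_fract (d * e):] * x ^ k \<in> integral_polys" if "k < Suc n" for k
    proof (cases "k = n")
      case True
      have "[:to_fract (d * e):] * x ^ k = [:to_fract d:] * ([:to_fract e:] * x ^ n)" using True by (simp add: mult.commute)
      thus ?thesis using integral_polys_closed(3)[OF integral_polys_const e(2)] by simp
    next
      case False
      have "[:to_fract (d * e):] * x ^ k = [:to_fract e:] * ([:to_fract d:] * x ^ k)"
        by (simp add: mult.commute)
      thus ?thesis using integral_polys_closed(3)[OF integral_polys_const d(2)] False that by simp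
    qed
    with d e show ?case by (intro exI[of _ "d * e"]) auto
  qed (auto intro: exI[of _ 1])
  then obtain d where d: "d \<noteq> 0" "\<And>k. k < ?n \<Longrightarrow> [:to_fract d:] * x ^ k \<in> integral_polys" by blast
  have "([:to_fract d:] * x ^ k) mod h \<in> integral_polys" for k
  proof (induction k rule: less_induct)
    case (less k)
    show ?case
    proof (cases "k < ?n")
      case True
      thus ?thesis using d integral_polys_mod by blast
    next
      case False
      have "int_eval p x = (\<Sum>i<?n. [:to_fract (coeff p i):] * x ^ i) + x ^ ?n"
        using p(1) by (simp add: int_eval_altdef lessThan_Suc_atMost[symmetric])
      hence "[(\<Sum>i<?n. [:to_fract (coeff p i):] * x ^ i) + x ^ ?n = 0] (mod h)" using p(2) by simp
      \<comment> \<open>Multiplying the integral equation by \<open>d x^(k-n)\<close> moves its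
        leading term to \<open>d x^k\<close> and the others to smaller exponents, where the
        induction hypothesis applies.\<close>
      hence "[([:to_fract d:] * x ^ (k - ?n)) * ((\<Sum>i<?n. [:to_fract (coeff p i):] * x ^ i) + x ^ ?n) =
          ([:to_fract d:] * x ^ (k - ?n)) * 0] (mod h)" by (rule cong_mult[OF cong_refl])
      moreover have "([:to_fract d:] * x ^ (k - ?n)) * ((\<Sum>i<?n. [:to_fract (coeff p i):] * x ^ i) + x ^ ?n)
        = [:to_fract d:] * x ^ k - (- (\<Sum>i<?n. [:to_fract (coeff p i):] * ([:to_fract d:] * x ^ (k - ?n + i))))"
        using False
        by (simp add: distrib_left sum_distrib_left mult_ac add.commute flip: power_add)
      ultimately have "[[:to_fract d:] * x ^ k =
          - (\<Sum>i<?n. [:to_fract (coeff p i):] * ([:to_fract d:] * x ^ (k - ?n + i)))] (mod h)"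
        by (simp only: mult_zero_right cong_diff_iff_cong_0)
      also have "[- (\<Sum>i<?n. [:to_fract (coeff p i):] * ([:to_fract d:] * x ^ (k - ?n + i))) =
          - (\<Sum>i<?n. [:to_fract (coeff p i):] * (([:to_fract d:] * x ^ (k - ?n + i)) mod h))] (mod h)"
        by (subst cong_minus_minus_iff) (intro cong_sum cong_mult cong_refl, simp add: cong_sym)
      finally have "([:to_fract d:] * x ^ k) mod h =
          (- (\<Sum>i<?n. [:to_fract (coeff p i):] * (([:to_fract d:] * x ^ (k - ?n + i)) mod h))) mod h"
        by (simp add: cong_def)
      also have "\<dots> \<in> integral_polys"
      proof (rule integral_polys_mod, rule integral_polys_uminus, rule integral_polys_sum)
        fix i assume "i \<in> {..<?n}"
        hence "k - ?n + i < k" using False by auto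
        thus "[:to_fract (coeff p i):] * (([:to_fract d:] * x ^ (k - ?n + i)) mod h) \<in> integral_polys"
          by (intro integral_polys_closed(3) less.IH) auto
      qed
      finally show ?thesis .
    qed
  qed
  with d(1) show ?thesis by (auto simp: bounded_denom_def)
qed

text \<open>With \<open>w = c^l m^i\<close>, the i-th coefficient of \<open>d x^(q^N)\<close> is
  \<open>d c w^(frob_exp N)\<close>. Clearing the denominator of \<open>c\<close> leaves
  \<open>d a\<close> as one fixed nonzero denominator for powers of \<open>w\<close> with unbounded
  exponent.\<close>

lemma coeff_if_bounded_denom:
  assumes "bounded_denom x" "degree x < l" "i < l"
  shows "coeff x i ^ l * M ^ i \<in> range to_fract"
proof (cases "coeff x i = 0")
  case False
  let ?c = "coeff x i" and ?w = "coeff x i ^ l * M ^ i"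
  obtain d where d: "d \<noteq> 0" "\<And>n. ([:to_fract d:] * x ^ n) mod h \<in> integral_polys"
    using assms(1) by (auto simp: bounded_denom_def)
  obtain a b where ab: "?c = to_fract a / to_fract b" "b \<noteq> 0" by (rule fract_eq_quotient)
  with False have "a \<noteq> 0" by auto
  show ?thesis
  proof (rule integral_of_bounded_denominators)
    show "d * a \<noteq> 0" using d \<open>a \<noteq> 0\<close> by simp
    fix N
    have "coeff (([:to_fract d:] * x ^ (q ^ N)) mod h) i = to_fract d * (?c ^ (q ^ N) * M ^ (i * frob_exp N))"
      using frobenius_coeff[OF assms(2,3), of N] by (simp add: mod_smult_left)
    also have "?c ^ (q ^ N) * M ^ (i * frob_exp N) = ?c * ?w ^ frob_exp N"
      by (simp add: q_power_eq power_mult power_mult_distrib)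
    finally have "to_fract d * (?c * ?w ^ frob_exp N) \<in> range to_fract"
      using integral_polysD[OF d(2)[of "q ^ N"], of i] by simp
    from range_to_fract_closed(3)[OF this range_to_fractI(1)[of b]]
    have "to_fract (d * a) * ?w ^ frob_exp N \<in> range to_fract" using ab by (simp add: mult_ac)
    thus "\<exists>n\<ge>N. to_fract (d * a) * ?w ^ n \<in> range to_fract" using frob_exp_ge by blast
  qed
qed (simp add: power_0_left)

text \<open>A sum of the eigenvectors $c_i X^i$ of the $q$-power map is killed by a monic $q$-polynomial,
  obtained by composing maps $T \mapsto T^q - w T$.\<close>
lemma additive_annihilator:
  fixes c :: "nat \<Rightarrow> 'a poly fract"
  assumes c: "\<And>i. i < l \<Longrightarrow> c i ^ l * M ^ i \<in> range to_fract" and "n \<le> l"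
  shows "\<exists>p. lead_coeff p = 1 \<and> degree p > 0 \<and> (\<forall>x y. int_eval p (x + y) = int_eval p x + int_eval p y) \<and>
    (\<forall>i<n. [int_eval p (monom (c i) i) = 0] (mod h)) \<and>
    (\<forall>i<l. \<exists>b. [int_eval p (monom (c i) i) = [:to_fract b:] * monom (c i) i] (mod h))"
  using assms(2)
proof (induction n)
  case 0
  have 1: "int_eval [:0, 1:] x = x" for x :: "'a poly fract poly" by (simp add: one_pCons[symmetric])
  show ?case by (rule exI[of _ "[:0, 1:]"]) (auto simp: 1 simp flip: one_pCons intro!: exI[of _ 1])
next
  case (Suc n)
  let ?u = "\<lambda>i. monom (c i) i"
  obtain p where p: "lead_coeff p = 1" "degree p > 0"
    "\<And>x y. int_eval p (x + y) = int_eval p x + int_eval p y"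
    "\<And>i. i < n \<Longrightarrow> [int_eval p (?u i) = 0] (mod h)"
    "\<And>i. i < l \<Longrightarrow> \<exists>b. [int_eval p (?u i) = [:to_fract b:] * ?u i] (mod h)"
    using Suc by auto
  have "\<forall>i\<in>{..<l}. \<exists>b. [int_eval p (?u i) = [:to_fract b:] * ?u i] (mod h)" using p(5) by blast
  then obtain b where b: "\<And>i. i < l \<Longrightarrow> [int_eval p (?u i) = [:to_fract (b i):] * ?u i] (mod h)"
    by (metis lessThan_iff)
  have "\<exists>w. [?u i ^ q = [:to_fract w:] * ?u i] (mod h)" if i: "i < l" for i
  proof -
    obtain v where v: "c i ^ l * M ^ i = to_fract v" using c[OF i] by blast
    \<comment> \<open>The eigenvalue of the q-power map on \<open>c_i X^i\<close> is a power of
      \<open>c_i^l m^i\<close>, so the hypothesis places it in A.\<close>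
    have "c i ^ q * M ^ (i * frob_exp 1) = (c i ^ l * M ^ i) ^ frob_exp 1 * c i"
    proof -
      have "c i ^ q = c i ^ (l * frob_exp 1 + 1)" using q_power_eq[of 1] by simp
      thus ?thesis by (simp only: power_mult power_mult_distrib power_add power_one_right mult_ac)
    qed
    also have "\<dots> = to_fract (v ^ frob_exp 1) * c i" using v by simp
    finally have "monom (c i ^ q * M ^ (i * frob_exp 1)) i = [:to_fract (v ^ frob_exp 1):] * ?u i"
      by (simp add: smult_monom)
    with frobenius_monom[OF i, of "c i" 1] show ?thesis by (metis power_one_right)
  qed
  hence "\<forall>i\<in>{..<l}. \<exists>w. [?u i ^ q = [:to_fract w:] * ?u i] (mod h)" by blast
  then obtain w where w: "\<And>i. i < l \<Longrightarrow> [?u i ^ q = [:to_fract (w i):] * ?u i] (mod h)"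
    by (metis lessThan_iff)
  \<comment> \<open>The polynomial \<open>T^q - v T\<close> sends the n-th eigenvector, already
    scaled by \<open>b n\<close>, to the multiple \<open>b n ^ q * w n - v * b n\<close> of
    \<open>?u n\<close>; this \<open>v\<close> makes the multiple vanish.\<close>
  define v where "v = w n * b n ^ (q - 1)"
  define r where "r = p ^ q - smult v p"
  have r: "int_eval r x = int_eval p x ^ q - [:to_fract v:] * int_eval p x" for x
    by (simp add: r_def int_eval_diff int_eval_power int_eval_smult)
  have deg: "degree (p ^ q) = q * degree p" using p(2) by (subst degree_power_eq) auto
  \<comment> \<open>Positivity of \<open>degree p\<close> is carried through the induction for this
    comparison, which keeps the new polynomial monic.\<close>
  have less: "degree (- smult v p) < degree (p ^ q)"
    using deg q_gt_1 p(2) by (auto intro: le_less_trans[OF degree_smult_le])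
  have r1: "degree r = q * degree p" "lead_coeff r = 1"
  proof -
    have "r = p ^ q + (- smult v p)" by (simp add: r_def)
    moreover have "lead_coeff (p ^ q) = 1" using p(1) by (simp add: lead_coeff_power)
    ultimately show "degree r = q * degree p" "lead_coeff r = 1"
      using degree_add_eq_left[OF less] deg less by (auto simp: coeff_eq_0 split: if_splits)
  qed
  have eig: "[int_eval r (?u i) = [:to_fract (b i ^ q * w i - v * b i):] * ?u i] (mod h)" if "i < l" for i
  proof -
    have "[int_eval r (?u i) = ([:to_fract (b i):] * ?u i) ^ q - [:to_fract v:] * ([:to_fract (b i):] * ?u i)] (mod h)"
      unfolding r using b[OF that] by (intro cong_diff cong_pow cong_mult cong_refl)
    also have "([:to_fract (b i):] * ?u i) ^ q - [:to_fract v:] * ([:to_fract (b i):] * ?u i) =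
      [:to_fract (b i ^ q):] * ?u i ^ q - [:to_fract (v * b i):] * ?u i"
      by (simp add: smult_power mult.commute)
    also have "[\<dots> = [:to_fract (b i ^ q):] * ([:to_fract (w i):] * ?u i) - [:to_fract (v * b i):] * ?u i] (mod h)"
      using w[OF that] by (intro cong_diff cong_mult cong_refl)
    also have "[:to_fract (b i ^ q):] * ([:to_fract (w i):] * ?u i) - [:to_fract (v * b i):] * ?u i
      = [:to_fract (b i ^ q * w i - v * b i):] * ?u i"
      by (simp add: smult_diff_left mult.commute)
    finally show ?thesis .
  qed
  have "[int_eval r (?u i) = 0] (mod h)" if "i < Suc n" for i
  proof (cases "i = n")
    case True
    have "b n ^ q = b n ^ (q - 1) * b n" using q_gt_1 by (metis power_minus_mult zero_less_one less_trans)
    hence "b n ^ q * w n - v * b n = 0" by (simp add: v_def)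
    with eig[of n] True Suc.prems show ?thesis by simp
  next
    case False
    hence "[int_eval r (?u i) = 0 ^ q - [:to_fract v:] * 0] (mod h)"
      unfolding r using that p(4)[of i] by (intro cong_diff cong_pow cong_mult cong_refl) auto
    thus ?thesis using q_gt_1 by (simp add: power_0_left)
  qed
  moreover have "int_eval r (x + y) = int_eval r x + int_eval r y" for x y
    using add_power_finite_field_card[where 'a='a, OF of_nat_poly_fract_poly, of "int_eval p x" "int_eval p y" 1]
    unfolding r by (simp add: p(3) q_eq algebra_simps)
  moreover have "degree r > 0" using r1 p(2) q_gt_1 by simp
  ultimately show ?case using r1(2) eig by blast
qed

lemma integral_if_coeff:
  assumes "degree x < l" and c: "\<And>i. i < l \<Longrightarrow> coeff x i ^ l * M ^ i \<in> range to_fract"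
  shows "x \<in> OK h"
proof -
  obtain p where p: "lead_coeff p = 1"
    "\<And>x y. int_eval p (x + y) = int_eval p x + int_eval p y"
    "\<And>i. i < l \<Longrightarrow> [int_eval p (monom (coeff x i) i) = 0] (mod h)"
    using additive_annihilator[of "coeff x" l, OF c] by auto
  have 0: "int_eval p 0 = 0" using p(2)[of 0 0] by (metis add_cancel_right_right add_0_right)
  have "int_eval p (sum f I) = (\<Sum>i\<in>I. int_eval p (f i))" for f :: "nat \<Rightarrow> 'a poly fract poly" and I
    by (induction I rule: infinite_finite_induct) (auto simp: 0 p(2))
  hence "int_eval p x = (\<Sum>i<l. int_eval p (monom (coeff x i) i))"
    using poly_eq_sum_monom[OF assms(1)] by metis
  also have "[\<dots> = (\<Sum>i<l. 0)] (mod h)" by (rule cong_sum) (simp add: p(3))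
  finally show ?thesis using assms(1) p(1) by (auto simp: mem_OK_iff)
qed

lemma OK_iff_coeff: "x \<in> OK h \<longleftrightarrow> degree x < l \<and> (\<forall>i<l. coeff x i ^ l * M ^ i \<in> range to_fract)"
  using integral_if_coeff coeff_if_bounded_denom bounded_denom_if_integral by (auto simp: mem_OK_iff)

lemma OK_iff_bounded_denom: "x \<in> OK h \<longleftrightarrow> degree x < l \<and> bounded_denom x"
  using integral_if_coeff coeff_if_bounded_denom bounded_denom_if_integral by (auto simp: mem_OK_iff)

lemma OK_degree: "x \<in> OK h \<Longrightarrow> degree x < l"
  by (simp add: mem_OK_iff)

lemma integral_polys_OK:
  assumes "x \<in> integral_polys"
  shows "x mod h \<in> OK h"
proof -
  have "(x mod h) ^ n mod h \<in> integral_polys" for n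
    using assms by (simp add: power_mod integral_polys_mod integral_polys_power)
  hence "bounded_denom (x mod h)"
    unfolding bounded_denom_def by (intro exI[of _ 1]) (simp flip: one_pCons)
  thus ?thesis by (simp add: OK_iff_bounded_denom)
qed

text \<open>The power \<open>(m c_i)^l\<close> equals \<open>(c_i^l m^i) m^(l-i)\<close> and so lies
  in A, which is closed under extracting such roots. Hence O_K lies between A[X] and
  \<open>1/m\<close> times A[X].\<close>

lemma OK_mult_m:
  assumes "x \<in> OK h"
  shows "[:M:] * x \<in> integral_polys"
proof -
  have "M * coeff x i \<in> range to_fract" for i
  proof (cases "i < l")
    case True
    have "(M * coeff x i) ^ l = coeff x i ^ l * M ^ i * M ^ (l - i)"
      using True by (simp add: power_mult_distrib mult_ac flip: power_add)
    also have "\<dots> \<in> range to_fract"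
      using assms True range_to_fract_power[OF range_to_fractI(1)]
      by (intro range_to_fract_closed(3)[of "_ * _"]) (auto simp: OK_iff_coeff)
    finally show ?thesis by (rule integrally_closed_power) simp
  next
    case False
    hence "coeff x i = 0" using OK_degree[OF assms] by (simp add: coeff_eq_0)
    thus ?thesis by simp
  qed
  thus ?thesis by (simp add: integral_polys_def)
qed

lemma bounded_denomE:
  assumes "x \<in> OK h"
  obtains d where "d \<noteq> 0" "\<And>n. ([:to_fract d:] * x ^ n) mod h \<in> integral_polys"
  using assms by (auto simp: OK_iff_bounded_denom bounded_denom_def)

text \<open>If \<open>d\<close> bounds the denominators of the powers of \<open>x\<close> and
  \<open>e\<close> those of \<open>y\<close>, then \<open>d e\<close> does so for the product. For
  the sum, the binomial expansion gives the same bound.\<close>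

lemma OK_mult:
  assumes "x \<in> OK h" "y \<in> OK h"
  shows "(x * y) mod h \<in> OK h"
proof -
  obtain d where d: "d \<noteq> 0" "\<And>n. ([:to_fract d:] * x ^ n) mod h \<in> integral_polys"
    using assms(1) by (rule bounded_denomE) blast
  obtain e where e: "e \<noteq> 0" "\<And>n. ([:to_fract e:] * y ^ n) mod h \<in> integral_polys"
    using assms(2) by (rule bounded_denomE) blast
  have "([:to_fract (d * e):] * (x * y mod h) ^ n) mod h \<in> integral_polys" for n
  proof -
    have "[[:to_fract (d * e):] * (x * y mod h) ^ n = [:to_fract (d * e):] * (x * y) ^ n] (mod h)"
      by (intro cong_mult cong_pow cong_refl) simp
    also have "[:to_fract (d * e):] * (x * y) ^ n = ([:to_fract d:] * x ^ n) * ([:to_fract e:] * y ^ n)"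
      by (simp add: power_mult_distrib mult_ac)
    also have "[\<dots> = (([:to_fract d:] * x ^ n) mod h) * (([:to_fract e:] * y ^ n) mod h)] (mod h)"
      by (intro cong_mult) (simp_all add: cong_sym)
    finally show ?thesis
      using integral_polys_mod[OF integral_polys_closed(3)[OF d(2) e(2)]] by (simp add: cong_def)
  qed
  hence "bounded_denom (x * y mod h)" using d e by (auto simp: bounded_denom_def intro!: exI[of _ "d * e"])
  thus ?thesis by (simp add: OK_iff_bounded_denom)
qed

lemma OK_add:
  assumes "x \<in> OK h" "y \<in> OK h"
  shows "x + y \<in> OK h"
proof -
  obtain d where d: "d \<noteq> 0" "\<And>n. ([:to_fract d:] * x ^ n) mod h \<in> integral_polys"
    using assms(1) by (rule bounded_denomE) blast
  obtain e where e: "e \<noteq> 0" "\<And>n. ([:to_fract e:] * y ^ n) mod h \<in> integral_polys"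
    using assms(2) by (rule bounded_denomE) blast
  have "([:to_fract (d * e):] * (x + y) ^ n) mod h \<in> integral_polys" for n
  proof -
    have "[:to_fract (d * e):] * (x + y) ^ n =
      (\<Sum>k\<le>n. of_nat (n choose k) * (([:to_fract d:] * x ^ k) * ([:to_fract e:] * y ^ (n - k))))"
    proof -
      have "[:to_fract (d * e):] = [:to_fract d:] * [:to_fract e:]" by simp
      thus ?thesis by (simp only: binomial_ring sum_distrib_left mult_ac)
    qed
    also have "[\<dots> = (\<Sum>k\<le>n. of_nat (n choose k) * ((([:to_fract d:] * x ^ k) mod h) * (([:to_fract e:] * y ^ (n - k)) mod h)))] (mod h)"
      by (intro cong_sum cong_mult cong_refl) (simp_all add: cong_sym)
    finally have "([:to_fract (d * e):] * (x + y) ^ n) mod h =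
      (\<Sum>k\<le>n. of_nat (n choose k) * ((([:to_fract d:] * x ^ k) mod h) * (([:to_fract e:] * y ^ (n - k)) mod h))) mod h"
      by (simp add: cong_def)
    also have "\<dots> \<in> integral_polys"
      by (intro integral_polys_mod integral_polys_sum integral_polys_closed(3) d e integral_polys_of_nat)
    finally show ?thesis .
  qed
  hence "bounded_denom (x + y)" using d e by (auto simp: bounded_denom_def intro!: exI[of _ "d * e"])
  moreover have "degree (x + y) < l" using assms by (auto intro: degree_add_less OK_degree)
  ultimately show ?thesis by (simp add: OK_iff_bounded_denom)
qed

lemma OK_const [simp]: "[:to_fract a:] \<in> OK h"
  using integral_polys_OK[OF integral_polys_const[of a]] by (simp add: mod_h_id)

lemma OK_0 [simp]: "0 \<in> OK h" and OK_1 [simp]: "1 \<in> OK h"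
  using OK_const[of 0] OK_const[of 1] by (simp_all flip: one_pCons)

lemma OK_uminus: "x \<in> OK h \<Longrightarrow> - x \<in> OK h"
  using OK_mult[OF OK_const[of "- 1"], of x] OK_degree[of x] by (simp add: mod_h_id)

end

section \<open>Lifting integral polynomials to A[X]\<close>

lemma integral_polysE:
  assumes "s \<in> integral_polys"
  obtains S where "s = fract_poly S"
proof -
  have "\<exists>S. s = fract_poly S" using assms
  proof (induction s)
    case (pCons c s)
    have "s \<in> integral_polys"
      unfolding integral_polys_def using integral_polysD[OF pCons.prems, of "Suc _"] by simp
    then obtain S where "s = fract_poly S" using pCons.IH by blast
    moreover obtain a where "c = to_fract a" using integral_polysD[OF pCons.prems, of 0] by auto
    ultimately have "pCons c s = fract_poly (pCons a S)" by (simp add: map_poly_pCons)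
    thus ?case by blast
  qed (auto intro: exI[of _ 0])
  with that show ?thesis by blast
qed

lemma fract_poly_integral [simp, intro]: "fract_poly S \<in> integral_polys"
  by (simp add: integral_polys_def coeff_map_poly)

lemma coeff_fract_poly [simp]: "coeff (fract_poly S) i = to_fract (coeff S i)"
  by (simp add: coeff_map_poly)

lemma degree_fract_poly [simp]: "degree (fract_poly S) = degree S"
  by (cases "S = 0") (auto intro: map_poly_degree_eq)

lemma fract_poly_eq_iff: "fract_poly S = fract_poly T \<longleftrightarrow> S = T"
  by (auto simp: poly_eq_iff)

lemma poly_div_mod_const:
  fixes R :: "'a::field poly poly"
  shows "R = smult g (map_poly (\<lambda>a. a div g) R) + map_poly (\<lambda>a. a mod g) R"
  by (rule poly_eqI) (simp add: coeff_map_poly)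

context kummer
begin

subsection \<open>The ring of integers\<close>

lemma OK_ring_simps [simp]:
  "carrier (OK_ring h) = OK h" "x \<otimes>\<^bsub>OK_ring h\<^esub> y = (x * y) mod h" "x \<oplus>\<^bsub>OK_ring h\<^esub> y = x + y"
  "\<one>\<^bsub>OK_ring h\<^esub> = 1" "\<zero>\<^bsub>OK_ring h\<^esub> = 0"
  by (simp_all add: OK_ring_def Kring_def)

lemma cring_OK_ring: "cring (OK_ring h)"
proof (rule cringI)
  show "abelian_group (OK_ring h)"
  proof (rule abelian_groupI)
    fix x assume "x \<in> carrier (OK_ring h)"
    thus "\<exists>y\<in>carrier (OK_ring h). y \<oplus>\<^bsub>OK_ring h\<^esub> x = \<zero>\<^bsub>OK_ring h\<^esub>"
      by (intro bexI[of _ "- x"]) (auto simp: OK_uminus)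
  qed (auto simp: OK_add algebra_simps)
  show "Group.comm_monoid (OK_ring h)"
    by (rule comm_monoidI) (auto simp: OK_mult mod_mult_left_eq mod_mult_right_eq mult_ac mod_h_id OK_degree)
qed (auto simp: distrib_right poly_mod_add_left)

lemma OK_ring_minus: "y \<in> OK h \<Longrightarrow> x \<ominus>\<^bsub>OK_ring h\<^esub> y = x - y"
proof -
  assume y: "y \<in> OK h"
  interpret cring "OK_ring h" by (rule cring_OK_ring)
  have "\<ominus>\<^bsub>OK_ring h\<^esub> y = - y" using y by (intro minus_equality) (auto simp: OK_uminus)
  thus ?thesis by (simp add: a_minus_def)
qed

lemma ideal_PIdl_OK: "ideal (PIdl\<^bsub>OK_ring h\<^esub> [:to_fract g:]) (OK_ring h)"
  by (rule cring.cgenideal_ideal[OF cring_OK_ring]) simp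

lemma mem_PIdl_OK: "y \<in> PIdl\<^bsub>OK_ring h\<^esub> [:to_fract g:] \<longleftrightarrow> (\<exists>x\<in>OK h. y = [:to_fract g:] * x)"
proof -
  have "x \<otimes>\<^bsub>OK_ring h\<^esub> [:to_fract g:] = [:to_fract g:] * x" if "x \<in> OK h" for x
    using OK_degree[OF that] by (simp add: mod_h_id mult.commute le_less_trans[OF degree_smult_le])
  thus ?thesis by (force simp: cgenideal_def simp del: OK_ring_simps(2))
qed

lemma OK_scale: "x \<in> OK h \<Longrightarrow> [:to_fract a:] * x \<in> OK h"
  using OK_mult[OF OK_const[of a], of x] OK_degree[of x]
  by (simp add: mod_h_id le_less_trans[OF degree_smult_le])

lemma integral_polys_degree_OK: "x \<in> integral_polys \<Longrightarrow> degree x < l \<Longrightarrow> x \<in> OK h"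
  using integral_polys_OK[of x] by (simp add: mod_h_id)

text \<open>As $m$ annihilates the quotient of the ring of integers by the order spanned by
  $1, X, \dots, X^{l-1}$, both have the same residue ring modulo any $g$ coprime to $m$.\<close>
lemma card_OK_Quot:
  assumes "degree g > 0" "coprime m g"
  shows "card (carrier (OK_ring h Quot PIdl\<^bsub>OK_ring h\<^esub> [:to_fract g:])) = q ^ (l * degree g)"
    "finite (carrier (OK_ring h Quot PIdl\<^bsub>OK_ring h\<^esub> [:to_fract g:]))"
proof -
  let ?I = "PIdl\<^bsub>OK_ring h\<^esub> [:to_fract g:]"
  define C where "C = {f :: 'a poly. degree f < degree g}"
  \<comment> \<open>The representatives: l coefficients, each a remainder modulo \<open>g\<close>,
    hence \<open>(q ^ degree g) ^ l\<close> in number.\<close>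
  define D where "D = {f. (\<forall>i. coeff f i \<in> C) \<and> (\<forall>i\<ge>l. coeff f i = 0)}"
  obtain u v where uv: "u * m + v * g = 1" using field_poly_bezout[OF assms(2)] by blast
  have "g \<noteq> 0" using assms(1) by auto
  have mod_C: "a mod g \<in> C" for a using degree_mod_less[OF \<open>g \<noteq> 0\<close>, of a] assms(1) by (auto simp: C_def)
  have deg_D: "degree f < l" if "f \<in> D" for f using that by (auto simp: D_def intro: degree_lessI)
  have D_OK: "fract_poly f \<in> OK h" if "f \<in> D" for f
    using deg_D[OF that] by (intro integral_polys_degree_OK) auto
  have bij: "bij_betw (\<lambda>x. ?I +>\<^bsub>OK_ring h\<^esub> x) (fract_poly ` D) (carrier (OK_ring h Quot ?I))"
  proof (rule bij_betw_representatives_Quot[OF ideal_PIdl_OK])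
    show "fract_poly ` D \<subseteq> carrier (OK_ring h)" using D_OK by auto
  next
    fix x assume "x \<in> carrier (OK_ring h)"
    hence x: "x \<in> OK h" by simp
    \<comment> \<open>From \<open>1 = u m + v g\<close>, the element \<open>x\<close> is congruent
      to \<open>u m x\<close> modulo \<open>g\<close>, and \<open>m x\<close> already has
      coefficients in A; these can be reduced modulo \<open>g\<close> one by one.\<close>
    have "[:to_fract u:] * ([:M:] * x) \<in> integral_polys"
      using OK_mult_m[OF x] by (rule integral_polys_closed(3)[OF integral_polys_const])
    then obtain Y where Y: "[:to_fract u:] * ([:M:] * x) = fract_poly Y" by (rule integral_polysE)
    have degY: "degree Y < l"
    proof -
      have "degree (fract_poly Y) \<le> degree x"
        unfolding Y[symmetric] by simp
      thus ?thesis using OK_degree[OF x] by simp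
    qed
    define T where "T = map_poly (\<lambda>a. a mod g) Y"
    define Z where "Z = map_poly (\<lambda>a. a div g) Y"
    have cY: "coeff Y i = 0" if "i \<ge> l" for i using that degY by (simp add: coeff_eq_0)
    have "T \<in> D" using mod_C cY by (auto simp: T_def D_def coeff_map_poly)
    have "degree Z < l" using cY by (intro degree_lessI) (auto simp: Z_def coeff_map_poly)
    hence Z: "fract_poly Z \<in> OK h" by (intro integral_polys_degree_OK) auto
    have "Y = smult g Z + T" unfolding T_def Z_def by (rule poly_div_mod_const)
    hence Y': "fract_poly Y = [:to_fract g:] * fract_poly Z + fract_poly T" by simp
    have "x = [:to_fract (u * m + v * g):] * x" unfolding uv by (simp flip: one_pCons)
    also have "\<dots> = [:to_fract u:] * ([:M:] * x) + [:to_fract g:] * ([:to_fract v:] * x)"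
      by (simp add: smult_add_left mult.commute)
    also have "\<dots> = [:to_fract g:] * (fract_poly Z + [:to_fract v:] * x) + fract_poly T"
      unfolding Y Y' by (simp only: distrib_left add_ac)
    finally have "x - fract_poly T = [:to_fract g:] * (fract_poly Z + [:to_fract v:] * x)"
      by (simp only: diff_eq_eq)
    moreover have "[:to_fract v:] * x \<in> OK h"
      using x by (rule OK_scale)
    ultimately have "x \<ominus>\<^bsub>OK_ring h\<^esub> fract_poly T \<in> ?I"
      using OK_add[OF Z] OK_ring_minus[OF D_OK[OF \<open>T \<in> D\<close>]] by (auto simp only: mem_PIdl_OK)
    with \<open>T \<in> D\<close> show "\<exists>t\<in>fract_poly ` D. x \<ominus>\<^bsub>OK_ring h\<^esub> t \<in> ?I" by blast
  next
    fix s t assume "s \<in> fract_poly ` D" "t \<in> fract_poly ` D" and I: "s \<ominus>\<^bsub>OK_ring h\<^esub> t \<in> ?I"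
    then obtain S T where ST: "s = fract_poly S" "t = fract_poly T" "S \<in> D" "T \<in> D" by auto
    obtain x where x: "x \<in> OK h" "s - t = [:to_fract g:] * x"
      using I ST OK_ring_minus[OF D_OK[OF ST(4)]] by (auto simp: mem_PIdl_OK)
    obtain Y where Y: "[:M:] * x = fract_poly Y" using OK_mult_m[OF x(1)] by (rule integral_polysE)
    \<comment> \<open>Multiplication by \<open>m\<close> brings the quotient by \<open>g\<close>
      into A[X], where coefficients can be compared; afterwards \<open>u m = 1 - v g\<close> cancels
      \<open>m\<close> modulo \<open>g\<close>.\<close>
    have "fract_poly (smult m (S - T)) = [:M:] * (s - t)" using ST by simp
    also have "\<dots> = [:to_fract g:] * ([:M:] * x)" using x(2) by (simp add: mult.commute)
    also have "\<dots> = fract_poly (smult g Y)" using Y by simp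
    finally have eq: "smult m (S - T) = smult g Y" by (simp only: fract_poly_eq_iff)
    have "coeff S i = coeff T i" for i
    proof -
      have "m * (coeff S i - coeff T i) = g * coeff Y i"
        using arg_cong[OF eq, of "\<lambda>p. coeff p i"] by simp
      hence "g dvd m * (coeff S i - coeff T i)" by simp
      have "coeff S i - coeff T i = u * (m * (coeff S i - coeff T i)) + g * (v * (coeff S i - coeff T i))"
        using uv by (metis (no_types, opaque_lifting) distrib_right mult.assoc mult.commute mult_1)
      with \<open>g dvd m * _\<close> have "g dvd coeff S i - coeff T i" by (metis dvd_add dvd_mult dvd_triv_left)
      moreover have "degree (coeff S i - coeff T i) < degree g"
        using ST(3,4) by (intro degree_diff_less) (auto simp: D_def C_def)
      ultimately have "coeff S i - coeff T i = 0" by (metis dvd_imp_degree_le not_less)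
      thus ?thesis by simp
    qed
    thus "s = t" using ST by (simp add: poly_eq_iff)
  qed
  have "0 \<in> C" using assms(1) by (simp add: C_def)
  have C: "finite C" "card C = q ^ degree g"
    using card_degree_less[OF assms(1), where 'a='a] by (simp_all add: C_def q_eq)
  have D: "finite D" "card D = (q ^ degree g) ^ l"
    using finite_card_bounded_coeffs[OF C(1) \<open>0 \<in> C\<close>, of l] C(2) by (simp_all add: D_def)
  have "card (fract_poly ` D) = card D" by (rule card_image) (auto simp: inj_on_def fract_poly_eq_iff)
  with D show "card (carrier (OK_ring h Quot ?I)) = q ^ (l * degree g)"
    using bij_betw_same_card[OF bij] by (simp add: mult.commute flip: power_mult)
  show "finite (carrier (OK_ring h Quot ?I))" using bij_betw_finite[OF bij] D(1) by simp
qed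

end

subsection \<open>Inert primes\<close>

lemma dvd_power_minus_one_mult:
  fixes p w :: "'b::comm_ring_1"
  assumes "p dvd w ^ n - 1"
  shows "p dvd w ^ (n * k) - 1"
proof (induction k)
  case (Suc k)
  have "w ^ (n * Suc k) - 1 = w ^ n * (w ^ (n * k) - 1) + (w ^ n - 1)"
    by (simp add: power_add algebra_simps)
  with Suc assms show ?case by (metis dvd_add dvd_mult)
qed simp

text \<open>An element whose order divides two coprime exponents is trivial, by Bezout. The modulus
  \<open>p\<close> may be 0, where divisibility means equality; the injectivity of the powers of
  \<open>zeta\<close> is obtained that way.\<close>

lemma dvd_power_minus_one_coprime:
  fixes p w :: "'b::comm_ring_1"
  assumes "p dvd w ^ n - 1" "p dvd w ^ k - 1" "coprime n k" "n \<noteq> 0"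
  shows "p dvd w - 1"
proof -
  obtain x y where xy: "n * x = k * y + gcd n k" using bezout_nat[OF assms(4)] by blast
  hence "w ^ (n * x) = w ^ (k * y) * w" using assms(3) by simp
  hence "w - 1 = (w ^ (n * x) - 1) - (w ^ (k * y) - 1) * w" by (simp add: algebra_simps)
  thus ?thesis using assms dvd_power_minus_one_mult by (metis dvd_diff dvd_mult2)
qed

text \<open>The condition \<open>nonresidue\<close> is Euler's criterion for \<open>m\<close> not
  being an l-th power modulo \<open>p\<close>.\<close>

locale kummer_inert = kummer +
  fixes p :: "'a poly"
  assumes irred_p: "irreducible p" and p_m: "\<not> p dvd m"
    and nonresidue: "\<not> p dvd m ^ ((q ^ degree p - 1) div l) - 1"
begin

text \<open>The eigenvalue of the \<open>q ^ degree p\<close>-power map on \<open>X\<close>; on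
  \<open>X^i\<close> it is \<open>w ^ i\<close>.\<close>

abbreviation "w \<equiv> m ^ frob_exp (degree p)"

lemma prime_p: "prime_elem p"
  using irred_p by (rule field_poly_irreducible_imp_prime)

lemma p_dvd_mult: "p dvd a * b \<longleftrightarrow> p dvd a \<or> p dvd b"
  using prime_p by (rule prime_elem_dvd_mult_iff)

lemma p_dvd_power: "p dvd a ^ n \<Longrightarrow> p dvd a"
  using prime_p by (rule prime_elem_dvd_power)

text \<open>Modulo \<open>p\<close>, Fermat gives \<open>w ^ l = 1\<close> and the non-residue
  condition gives \<open>w\<close> different from 1; as \<open>l\<close> is prime, \<open>w\<close>
  is a primitive l-th root of unity.\<close>

lemma w_power_diff:
  assumes "i < l" "j < l" "i \<noteq> j"
  shows "\<not> p dvd w ^ i - w ^ j"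
proof -
  have *: "\<not> p dvd w ^ j - w ^ i" if "i < j" "j < l" for i j
  proof
    assume dvd: "p dvd w ^ j - w ^ i"
    have "w ^ j - w ^ i = w ^ i * (w ^ (j - i) - 1)"
      using that by (simp add: right_diff_distrib flip: power_add)
    with dvd have "p dvd w ^ (j - i) - 1" using p_m p_dvd_mult p_dvd_power by metis
    moreover have "p dvd w ^ l - 1"
    proof -
      have "m ^ q ^ degree p - m = m * (w ^ l - 1)"
        by (simp add: q_power_eq right_diff_distrib mult.commute flip: power_mult)
      thus ?thesis using poly_fermat[OF irred_p, of m] p_m p_dvd_mult by (metis q_eq)
    qed
    moreover have "coprime (j - i) l"
    proof -
      have "\<not> l dvd j - i" using that by (auto dest: dvd_imp_le)
      thus ?thesis using prime_l by (metis coprime_commute prime_imp_coprime)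
    qed
    ultimately have "p dvd w - 1" using that by (intro dvd_power_minus_one_coprime[of p w "j - i" l]) auto
    thus False using nonresidue by (simp add: frob_exp_def)
  qed
  show ?thesis using *[of i j] *[of j i] assms by (metis dvd_diff_commute linorder_neqE_nat)
qed

text \<open>Induction on the number of coefficients not divisible by \<open>p\<close>. While two
  remain, a multiple of \<open>R\<close> loses one of them and keeps the others; a single surviving
  monomial is invertible because \<open>X\<close> divides the unit \<open>m\<close>.\<close>

lemma unit_mod_p:
  assumes "degree R < l" "\<exists>i. \<not> p dvd coeff R i"
  shows "\<exists>s\<in>integral_polys. \<exists>a\<in>integral_polys. [s * fract_poly R = 1 + [:to_fract p:] * a] (mod h)"
  using assms
proof (induction "card {i. \<not> p dvd coeff R i}" arbitrary: R rule: less_induct)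
  case less
  let ?supp = "\<lambda>R. {i. \<not> p dvd coeff R i}"
  have sub: "?supp R \<subseteq> {..<l}" using less.prems(1) by (auto intro: ccontr simp: coeff_eq_0)
  hence fin: "finite (?supp R)" by (rule finite_subset) simp
  obtain i where i: "\<not> p dvd coeff R i" using less.prems(2) by blast
  have il: "i < l" using sub i by auto
  show ?case
  proof (cases "?supp R = {i}")
    case True
    define Z where "Z = map_poly (\<lambda>a. a div p) (R - monom (coeff R i) i)"
    have "R - monom (coeff R i) i = smult p Z"
    proof (rule poly_eqI)
      fix k
      have "p dvd coeff (R - monom (coeff R i) i) k" using True by auto
      thus "coeff (R - monom (coeff R i) i) k = coeff (smult p Z) k"
        by (simp add: Z_def coeff_map_poly)
    qed
    hence "R = monom (coeff R i) i + smult p Z" by (simp only: diff_eq_eq add.commute)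
    hence R: "fract_poly R = monom (to_fract (coeff R i)) i + [:to_fract p:] * fract_poly Z"
      by (metis (no_types, lifting) fract_poly_add fract_poly_smult map_poly_monom mult_pCons_left mult_zero_left pCons_0_0 smult_conv_map_poly to_fract_0 add_0_right)
    obtain u v where uv: "u * p + v * coeff R i = 1" using field_poly_irreducible_bezout[OF irred_p i] by blast
    obtain u' v' where uv': "u' * p + v' * m = 1" using field_poly_irreducible_bezout[OF irred_p p_m] by blast
    \<comment> \<open>Here \<open>v\<close> inverts the coefficient and \<open>v'\<close> inverts
      \<open>m\<close> modulo \<open>p\<close>; the exponent \<open>l - i\<close> completes
      \<open>X^i\<close> to \<open>X^l\<close>, that is, to \<open>m\<close>.\<close>
    define s where "s = monom (to_fract (v * v')) (l - i)"
    have "s * monom (to_fract (coeff R i)) i = monom (to_fract (v * v' * coeff R i)) l"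
      using il by (simp add: s_def mult_monom)
    also have "[\<dots> = [:to_fract (v * v' * coeff R i) * M:]] (mod h)"
      using monom_cong[of "to_fract (v * v' * coeff R i)" l] by (simp add: monom_0)
    also have "to_fract (v * v' * coeff R i) * M = to_fract ((v * coeff R i) * (v' * m))" by (simp add: mult_ac)
    also have "(v * coeff R i) * (v' * m) = (1 - u * p) * (1 - u' * p)"
      using uv uv' by (metis add_diff_cancel_left')
    also have "\<dots> = 1 + p * (u * u' * p - u - u')" by (simp add: algebra_simps)
    finally have "[s * monom (to_fract (coeff R i)) i = [:to_fract (1 + p * (u * u' * p - u - u')):]] (mod h)" .
    moreover have "[:to_fract (1 + p * (u * u' * p - u - u')):] = 1 + [:to_fract p:] * [:to_fract (u * u' * p - u - u'):]"
      by (simp add: one_pCons[where 'a = "'a poly fract"])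
    ultimately have "[s * monom (to_fract (coeff R i)) i = 1 + [:to_fract p:] * [:to_fract (u * u' * p - u - u'):]] (mod h)"
      by simp
    hence "[s * monom (to_fract (coeff R i)) i + s * ([:to_fract p:] * fract_poly Z) =
      (1 + [:to_fract p:] * [:to_fract (u * u' * p - u - u'):]) + s * ([:to_fract p:] * fract_poly Z)] (mod h)"
      by (rule cong_add) simp
    hence "[s * fract_poly R = 1 + [:to_fract p:] * ([:to_fract (u * u' * p - u - u'):] + s * fract_poly Z)] (mod h)"
      unfolding R by (simp only: distrib_left mult_ac add_ac)
    moreover have "s \<in> integral_polys" unfolding s_def by (rule integral_polys_monom)
    moreover have "[:to_fract (u * u' * p - u - u'):] + s * fract_poly Z \<in> integral_polys"
      using \<open>s \<in> integral_polys\<close>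
      by (rule integral_polys_closed(1)[OF integral_polys_const integral_polys_closed(3)[OF _ fract_poly_integral]])
    ultimately show ?thesis by blast
  next
    case False
    then obtain j where j: "j \<noteq> i" "\<not> p dvd coeff R j" using i by blast
    have jl: "j < l" using sub j by auto
    let ?d = "degree p" and ?r = "fract_poly R"
    \<comment> \<open>Multiplying by \<open>f\<close> applies the \<open>q ^ degree p\<close>-power
      map minus the eigenvalue \<open>w ^ j\<close>, yet visibly yields a multiple of
      \<open>R\<close>.\<close>
    define f where "f = ?r ^ (q ^ ?d - 1) - [:to_fract (w ^ j):]"
    have f: "f \<in> integral_polys" unfolding f_def
      by (rule integral_polys_closed(2)[OF integral_polys_power[OF fract_poly_integral] integral_polys_const])
    have "?r ^ (q ^ ?d) = ?r ^ (q ^ ?d - 1) * ?r" by (simp add: q_power_eq)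
    hence fr: "f * ?r = ?r ^ (q ^ ?d) - [:to_fract (w ^ j):] * ?r" by (simp add: f_def left_diff_distrib)
    have "(f * ?r) mod h \<in> integral_polys" using f by (intro integral_polys_mod integral_polys_closed) auto
    then obtain R' where R': "(f * ?r) mod h = fract_poly R'" by (rule integral_polysE)
    have coeff_R': "coeff R' k = coeff R k ^ (q ^ ?d) * w ^ k - w ^ j * coeff R k" if "k < l" for k
    proof -
      have "to_fract (coeff R' k) = coeff ((f * ?r) mod h) k" by (simp add: R')
      also have "\<dots> = coeff (?r ^ (q ^ ?d) mod h) k - coeff (([:to_fract (w ^ j):] * ?r) mod h) k"
        by (simp add: fr poly_mod_diff_left)
      also have "coeff (?r ^ (q ^ ?d) mod h) k = to_fract (coeff R k ^ (q ^ ?d) * w ^ k)"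
        using frobenius_coeff[of ?r k ?d] less.prems(1) that by (simp add: mult.commute flip: power_mult)
      also have "coeff (([:to_fract (w ^ j):] * ?r) mod h) k = to_fract (w ^ j * coeff R k)"
        using less.prems(1) by (simp add: mod_smult_left mod_h_id)
      finally have "to_fract (coeff R' k) = to_fract (coeff R k ^ (q ^ ?d) * w ^ k - w ^ j * coeff R k)"
        by (simp only: to_fract_diff)
      thus ?thesis by (simp only: to_fract_eq_iff)
    qed
    \<comment> \<open>By Fermat the k-th coefficient becomes
      \<open>coeff R k * (w ^ k - w ^ j)\<close> modulo \<open>p\<close>, and the second factor
      vanishes modulo \<open>p\<close> only for \<open>k = j\<close>.\<close>
    have supp: "p dvd coeff R' k \<longleftrightarrow> p dvd coeff R k \<or> k = j" if "k < l" for k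
    proof -
      have "coeff R' k = (coeff R k ^ (q ^ ?d) - coeff R k) * w ^ k + coeff R k * (w ^ k - w ^ j)"
        by (simp add: coeff_R'[OF that] algebra_simps)
      moreover have "p dvd (coeff R k ^ (q ^ ?d) - coeff R k) * w ^ k"
        using poly_fermat[OF irred_p, of "coeff R k"] by (simp add: q_eq)
      ultimately have "p dvd coeff R' k \<longleftrightarrow> p dvd coeff R k * (w ^ k - w ^ j)"
        by (simp add: dvd_add_right_iff)
      also have "\<dots> \<longleftrightarrow> p dvd coeff R k \<or> p dvd w ^ k - w ^ j" by (rule p_dvd_mult)
      also have "p dvd w ^ k - w ^ j \<longleftrightarrow> k = j" using w_power_diff[OF that jl] by auto
      finally show ?thesis .
    qed
    have deg: "degree R' < l" using degree_fract_poly[of R'] mod_h_degree[of "f * ?r"] unfolding R' by simp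
    have "?supp R' \<subseteq> ?supp R - {j}"
    proof
      fix k assume k: "k \<in> ?supp R'"
      hence "k < l" using deg by (auto intro: ccontr simp: coeff_eq_0)
      with supp k show "k \<in> ?supp R - {j}" by auto
    qed
    also have "\<dots> \<subset> ?supp R" using j by auto
    finally have "card (?supp R') < card (?supp R)" using fin by (rule psubset_card_mono[rotated])
    moreover have "\<not> p dvd coeff R' i" using supp[OF il] i j by auto
    ultimately obtain s a where sa: "s \<in> integral_polys" "a \<in> integral_polys"
      "[s * fract_poly R' = 1 + [:to_fract p:] * a] (mod h)"
      using less.hyps[of R'] deg by blast
    have "[(s * f) * ?r = s * fract_poly R'] (mod h)"
      unfolding R'[symmetric] mult.assoc by (intro cong_mult cong_refl) (simp add: cong_sym)
    hence "[(s * f) * ?r = 1 + [:to_fract p:] * a] (mod h)" using sa(3) by (rule cong_trans)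
    with sa f show ?thesis using integral_polys_closed(3) by blast
  qed
qed

text \<open>Among the multiples of \<open>f\<close> with coefficients in A, take one whose leading
  coefficient has least degree; dividing all coefficients by \<open>p\<close> would lower that
  degree.\<close>

lemma primitive_multiple:
  fixes f :: "'a poly fract poly"
  assumes "f \<noteq> 0"
  shows "\<exists>c R. c \<noteq> 0 \<and> smult c f = fract_poly R \<and> (\<exists>i. \<not> p dvd coeff R i)"
proof -
  let ?P = "\<lambda>R. \<exists>c. c \<noteq> 0 \<and> smult c f = fract_poly R"
  obtain d where "d \<noteq> 0" "[:to_fract d:] * f \<in> integral_polys" using common_denominator by blast
  then obtain R0 where "to_fract d \<noteq> 0 \<and> smult (to_fract d) f = fract_poly R0"
    by (auto elim: integral_polysE)
  hence "?P R0" by blast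
  then obtain R where R: "?P R" and min: "\<And>R'. ?P R' \<Longrightarrow> degree (lead_coeff R) \<le> degree (lead_coeff R')"
    using arg_min_nat_lemma[of ?P R0 "\<lambda>R. degree (lead_coeff R)"] by blast
  then obtain c where c: "c \<noteq> 0" "smult c f = fract_poly R" by blast
  have "\<exists>i. \<not> p dvd coeff R i"
  proof (rule ccontr)
    assume "\<nexists>i. \<not> p dvd coeff R i"
    hence dvd: "p dvd coeff R i" for i by blast
    define R' where "R' = map_poly (\<lambda>a. a div p) R"
    have RR': "R = smult p R'"
      using dvd by (intro poly_eqI) (simp add: R'_def coeff_map_poly)
    have p0: "p \<noteq> 0" using irred_p by auto
    have "smult (c / to_fract p) f = smult (inverse (to_fract p)) (smult c f)"
      by (simp add: divide_inverse mult.commute)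
    also have "\<dots> = fract_poly R'" using c(2) RR' p0 by simp
    finally have "?P R'" using c(1) p0 by (intro exI[of _ "c / to_fract p"]) auto
    hence "degree (lead_coeff R) \<le> degree (lead_coeff R')" by (rule min)
    moreover have "R' \<noteq> 0" using c assms RR' by auto
    moreover have "lead_coeff R = p * lead_coeff R'" using RR' by simp
    ultimately show False using p0 irreducible_degree_pos[OF irred_p] by (simp add: degree_mult_eq)
  qed
  with c show ?thesis by blast
qed

text \<open>A proper factor, scaled to be primitive at \<open>p\<close>, is a unit modulo
  \<open>p\<close>. Its product with the other scaled factor \<open>K\<close> is 0 modulo
  \<open>h\<close>, so \<open>K\<close> would be divisible by \<open>p\<close>, against
  primitivity.\<close>

lemma irreducible_h: "irreducible h"
proof (rule irreducibleI)
  show "h \<noteq> 0" by simp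
  show "\<not> h dvd 1" by (simp add: is_unit_iff_degree)
  fix f k assume fk: "h = f * k"
  show "f dvd 1 \<or> k dvd 1"
  proof (rule ccontr)
    assume *: "\<not> (f dvd 1 \<or> k dvd 1)"
    have 0: "f \<noteq> 0" "k \<noteq> 0" using fk h_nz by auto
    with * have "degree f > 0" "degree k > 0" by (auto simp: is_unit_iff_degree)
    moreover have "degree f + degree k = l" using fk degree_h 0 by (metis degree_mult_eq)
    ultimately have deg: "degree f < l" "degree k < l" by auto
    obtain c F where F: "c \<noteq> 0" "smult c f = fract_poly F" "\<exists>i. \<not> p dvd coeff F i"
      using primitive_multiple[OF 0(1)] by blast
    obtain d K where K: "d \<noteq> 0" "smult d k = fract_poly K" "\<exists>i. \<not> p dvd coeff K i"
      using primitive_multiple[OF 0(2)] by blast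
    have dF: "degree F < l" using degree_fract_poly[of F] deg(1) F(1) by (simp flip: F(2))
    have dK: "degree (fract_poly K) < l" using deg(2) K(1) by (simp flip: K(2))
    obtain s a where sa: "s \<in> integral_polys" "a \<in> integral_polys"
      "[s * fract_poly F = 1 + [:to_fract p:] * a] (mod h)"
      using unit_mod_p[OF dF F(3)] by blast
    have "fract_poly F * fract_poly K = smult (c * d) h" by (simp add: fk mult.commute flip: F(2) K(2))
    hence FK: "s * fract_poly F * fract_poly K = h * (smult (c * d) s)" by (simp add: mult.assoc mult.commute[of h])
    have "[s * fract_poly F * fract_poly K = (1 + [:to_fract p:] * a) * fract_poly K] (mod h)"
      using sa(3) by (rule cong_mult) simp
    hence "[(1 + [:to_fract p:] * a) * fract_poly K = 0] (mod h)"
      unfolding FK by (metis cong_0_iff cong_sym_eq cong_trans dvd_triv_left)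
    hence "[fract_poly K + [:to_fract p:] * (a * fract_poly K) = 0] (mod h)"
      by (simp add: distrib_right)
    hence "(fract_poly K + [:to_fract p:] * (a * fract_poly K)) mod h = 0" by (simp add: cong_def)
    hence "fract_poly K = [:to_fract p:] * (- ((a * fract_poly K) mod h))"
      using dK by (simp add: poly_mod_add_left mod_h_id mod_smult_left eq_neg_iff_add_eq_0)
    moreover have "- ((a * fract_poly K) mod h) \<in> integral_polys"
      using sa(2) by (intro integral_polys_uminus integral_polys_mod integral_polys_closed) auto
    then obtain Z where "- ((a * fract_poly K) mod h) = fract_poly Z" by (rule integral_polysE)
    ultimately have "fract_poly K = fract_poly (smult p Z)" by simp
    hence "K = smult p Z" by (simp only: fract_poly_eq_iff)
    with K(3) show False by simp
  qed
qed

lemma coprime_m_p: "coprime m p"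
proof -
  obtain u v where "u * p + v * m = 1" using field_poly_irreducible_bezout[OF irred_p p_m] by blast
  thus ?thesis by (intro coprimeI) (metis dvd_add dvd_mult)
qed

text \<open>For \<open>x\<close> outside \<open>p\<close> O_K, the polynomial \<open>m x\<close> of
  A[X] is not divisible by \<open>p\<close>, since otherwise \<open>x = u (m x) + p v x\<close>
  would lie in \<open>p\<close> O_K. If \<open>s\<close> inverts \<open>m x\<close> modulo
  \<open>p\<close>, then \<open>s m\<close> inverts \<open>x\<close>.\<close>

lemma field_OK_Quot: "field (OK_ring h Quot PIdl\<^bsub>OK_ring h\<^esub> [:to_fract p:])"
proof (rule Quot_fieldI[OF cring_OK_ring ideal_PIdl_OK])
  let ?I = "PIdl\<^bsub>OK_ring h\<^esub> [:to_fract p:]"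
  obtain u v where uv: "u * m + v * p = 1" using field_poly_bezout[OF coprime_m_p] by blast
  show "\<one>\<^bsub>OK_ring h\<^esub> \<notin> ?I"
  proof
    assume "\<one>\<^bsub>OK_ring h\<^esub> \<in> ?I"
    then obtain x where x: "x \<in> OK h" "1 = [:to_fract p:] * x" by (auto simp: mem_PIdl_OK)
    obtain Y where "[:M:] * x = fract_poly Y" using OK_mult_m[OF x(1)] by (rule integral_polysE)
    hence "fract_poly (smult p Y) = [:M:] * ([:to_fract p:] * x)" by (simp add: mult.commute flip: \<open>[:M:] * x = fract_poly Y\<close>)
    also have "\<dots> = [:M:]" by (simp only: x(2)[symmetric] mult_1_right)
    finally have "coeff (fract_poly (smult p Y)) 0 = M" by simp
    hence "to_fract (p * coeff Y 0) = to_fract m" by simp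
    hence "p * coeff Y 0 = m" by (simp only: to_fract_eq_iff)
    with p_m show False by auto
  qed
  fix x assume "x \<in> carrier (OK_ring h)" and nI: "x \<notin> ?I"
  hence x: "x \<in> OK h" by simp
  obtain Y where Y: "[:M:] * x = fract_poly Y" using OK_mult_m[OF x] by (rule integral_polysE)
  have degY: "degree Y < l" using degree_fract_poly[of Y] OK_degree[OF x] m_nz by (simp flip: Y)
  have "\<exists>i. \<not> p dvd coeff Y i"
  proof (rule ccontr)
    assume "\<nexists>i. \<not> p dvd coeff Y i"
    hence dvd: "p dvd coeff Y i" for i by blast
    define Y' where "Y' = map_poly (\<lambda>a. a div p) Y"
    have YY': "Y = smult p Y'"
      using dvd by (intro poly_eqI) (simp add: Y'_def coeff_map_poly)
    hence "degree Y' < l" using degY irred_p by (cases "p = 0") auto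
    hence Y'OK: "fract_poly Y' \<in> OK h" by (intro integral_polys_degree_OK) auto
    have "x = [:to_fract (u * m + v * p):] * x" unfolding uv by (simp flip: one_pCons)
    also have "\<dots> = [:to_fract u:] * ([:M:] * x) + [:to_fract p:] * ([:to_fract v:] * x)"
      by (simp add: smult_add_left mult.commute)
    also have "[:M:] * x = [:to_fract p:] * fract_poly Y'" unfolding Y YY' by simp
    finally have "x = [:to_fract p:] * ([:to_fract u:] * fract_poly Y' + [:to_fract v:] * x)"
      by (simp only: distrib_left mult.left_commute)
    hence "x \<in> ?I" using OK_add[OF OK_scale[OF Y'OK] OK_scale[OF x]] unfolding mem_PIdl_OK by blast
    with nI show False ..
  qed
  then obtain s a where sa: "s \<in> integral_polys" "a \<in> integral_polys"
      "[s * fract_poly Y = 1 + [:to_fract p:] * a] (mod h)"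
    using unit_mod_p[OF degY] by blast
  define y where "y = (s * [:M:]) mod h"
  have y: "y \<in> OK h" unfolding y_def using sa(1) by (intro integral_polys_OK integral_polys_closed) auto
  have a: "a mod h \<in> OK h" using sa(2) by (rule integral_polys_OK)
  have "[x * y = x * (s * [:M:])] (mod h)" unfolding y_def by (intro cong_mult) auto
  also have "x * (s * [:M:]) = s * fract_poly Y" unfolding Y[symmetric] by (simp only: mult_ac)
  also note sa(3)
  also have "[1 + [:to_fract p:] * a = 1 + [:to_fract p:] * (a mod h)] (mod h)"
    by (intro cong_add cong_mult cong_refl) (simp add: cong_sym)
  finally have "(x * y) mod h = (1 + [:to_fract p:] * (a mod h)) mod h" by (simp add: cong_def)
  also have "\<dots> = 1 + [:to_fract p:] * (a mod h)"
    using OK_degree[OF OK_add[OF OK_1 OK_scale[OF a, of p]]] by (rule mod_h_id)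
  finally have "x \<otimes>\<^bsub>OK_ring h\<^esub> y \<ominus>\<^bsub>OK_ring h\<^esub> \<one>\<^bsub>OK_ring h\<^esub> = [:to_fract p:] * (a mod h)"
    by (simp add: OK_ring_minus)
  hence "x \<otimes>\<^bsub>OK_ring h\<^esub> y \<ominus>\<^bsub>OK_ring h\<^esub> \<one>\<^bsub>OK_ring h\<^esub> \<in> ?I"
    using a unfolding mem_PIdl_OK by blast
  with y show "\<exists>y\<in>carrier (OK_ring h). x \<otimes>\<^bsub>OK_ring h\<^esub> y \<ominus>\<^bsub>OK_ring h\<^esub> \<one>\<^bsub>OK_ring h\<^esub> \<in> ?I" by auto
qed

lemma not_carmichael_in:
  assumes g: "p dvd g" "degree g > 0" "coprime m g" and *: "irreducible g \<or> \<not> degree p dvd degree g"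
  shows "\<not> carmichael_in h g"
proof
  assume "carmichael_in h g"
  hence C: "carmichael_ring (OK_ring h Quot PIdl\<^bsub>OK_ring h\<^esub> [:to_fract g:])"
    by (simp add: carmichael_in_def carmichael_ideal_def to_fract_def)
  show False
  proof (cases "irreducible g")
    case True
    then obtain k where k: "g = p * k" "k dvd 1"
      using g(1) irred_p by (metis dvdE irreducibleD irreducible_not_unit)
    then obtain k' where k': "k * k' = 1" by (metis dvdE)
    have "PIdl\<^bsub>OK_ring h\<^esub> [:to_fract g:] = PIdl\<^bsub>OK_ring h\<^esub> [:to_fract p:]"
    proof -
      have 1: "[:to_fract g:] * x = [:to_fract p:] * ([:to_fract k:] * x)" for x by (simp add: k mult.commute)
      have "g * k' = p" using k k' by (simp add: mult.assoc)
      hence 2: "[:to_fract p:] * x = [:to_fract g:] * ([:to_fract k':] * x)" for x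
        by (metis (no_types, opaque_lifting) mult.assoc mult_pCons_left mult_zero_left pCons_0_0 smult_smult to_fract_mult add_0_right)
      show ?thesis unfolding set_eq_iff mem_PIdl_OK using 1 2 OK_scale by metis
    qed
    with C field_OK_Quot show False by (simp add: carmichael_ring_def)
  next
    case False
    let ?I = "PIdl\<^bsub>OK_ring h\<^esub> [:to_fract g:]" and ?J = "PIdl\<^bsub>OK_ring h\<^esub> [:to_fract p:]"
    let ?L = "OK_ring h Quot ?J" and ?N = "q ^ (l * degree g)"
    interpret L: field ?L by (rule field_OK_Quot)
    note cg = card_OK_Quot[OF g(2,3)]
    note cp = card_OK_Quot[OF irreducible_degree_pos[OF irred_p] coprime_m_p]
    \<comment> \<open>The inclusion lets the power identity descend from O_K/g to O_K/p, where a
      generator of the unit group can be used.\<close>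
    have IJ: "?I \<subseteq> ?J"
    proof
      fix y assume "y \<in> ?I"
      then obtain x where x: "x \<in> OK h" "y = [:to_fract g:] * x" by (auto simp: mem_PIdl_OK)
      obtain k where "g = p * k" using g(1) by (auto elim: dvdE)
      hence "y = [:to_fract p:] * ([:to_fract k:] * x)" using x(2) by (simp add: mult.commute)
      moreover have "[:to_fract k:] * x \<in> OK h"
        using x(1) by (rule OK_scale)
      ultimately show "y \<in> ?J" unfolding mem_PIdl_OK by blast
    qed
    have pow: "X [^]\<^bsub>?L\<^esub> ?N = X" if X: "X \<in> carrier ?L" for X
    proof -
      obtain x where x: "x \<in> carrier (OK_ring h)" "X = ?J +>\<^bsub>OK_ring h\<^esub> x" using X by (auto simp: carrier_Quot)
      have closed: "x [^]\<^bsub>OK_ring h\<^esub> ?N \<in> carrier (OK_ring h)"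
        using x(1) cring_OK_ring by (meson cring.axioms(1) monoid.nat_pow_closed ring.axioms(2))
      have "?I +>\<^bsub>OK_ring h\<^esub> x \<in> carrier (OK_ring h Quot ?I)" using x(1) by (auto simp only: carrier_Quot)
      hence "(?I +>\<^bsub>OK_ring h\<^esub> x) [^]\<^bsub>OK_ring h Quot ?I\<^esub> ?N = ?I +>\<^bsub>OK_ring h\<^esub> x"
        using C cg(1) by (simp add: carmichael_ring_def)
      hence "x [^]\<^bsub>OK_ring h\<^esub> ?N \<ominus>\<^bsub>OK_ring h\<^esub> x \<in> ?I"
        using Quot_nat_pow[OF ideal_PIdl_OK x(1)] Quot_eq_iff[OF ideal_PIdl_OK closed x(1)] by simp
      hence "?J +>\<^bsub>OK_ring h\<^esub> (x [^]\<^bsub>OK_ring h\<^esub> ?N) = ?J +>\<^bsub>OK_ring h\<^esub> x"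
        using IJ Quot_eq_iff[OF ideal_PIdl_OK closed x(1)] by blast
      thus ?thesis using Quot_nat_pow[OF ideal_PIdl_OK x(1)] x(2) by simp
    qed
    obtain a where a: "a \<in> carrier ?L" "a \<noteq> \<zero>\<^bsub>?L\<^esub>"
      "\<And>n::nat. a [^]\<^bsub>?L\<^esub> n = \<one>\<^bsub>?L\<^esub> \<longleftrightarrow> q ^ (l * degree p) - 1 dvd n"
      using L.finite_field_generator[OF cp(2)] by (auto simp: cp(1))
    have "?N > 0" using q_gt_1 by simp
    then obtain n where n: "?N = Suc n" by (cases ?N) auto
    have "a \<otimes>\<^bsub>?L\<^esub> (a [^]\<^bsub>?L\<^esub> n) = a \<otimes>\<^bsub>?L\<^esub> \<one>\<^bsub>?L\<^esub>"
      using pow[OF a(1)] a(1) unfolding n by (simp add: L.m_comm)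
    hence "a [^]\<^bsub>?L\<^esub> n = \<one>\<^bsub>?L\<^esub>"
      using L.m_lcancel[OF a(2,1) L.nat_pow_closed[OF a(1)] L.one_closed] by simp
    hence "q ^ (l * degree p) - 1 dvd ?N - 1" using a(3) n by simp
    \<comment> \<open>The common factor \<open>l\<close> cancels, which leaves precisely the
      divisibility excluded for \<open>p\<close>.\<close>
    hence "l * degree p dvd l * degree g" using q_gt_1 power_minus_one_dvd_power_minus_one by blast
    with * False show False by simp
  qed
qed

end

subsection \<open>Automorphisms and isomorphisms\<close>

text \<open>As polynomials in \<open>a\<close>, both sides are monic of degree \<open>l\<close> and
  vanish at the points \<open>z ^ j * b\<close>. These are \<open>l\<close> distinct points only for
  nonzero \<open>b\<close>, hence the case distinction.\<close>

lemma power_minus_prod_roots_of_unity: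
  fixes a b z :: "'b::idom"
  assumes "l > 0" "z ^ l = 1" "inj_on (\<lambda>j. z ^ j) {..<l}"
  shows "a ^ l - b ^ l = (\<Prod>j<l. a - z ^ j * b)"
proof (cases "b = 0")
  case True
  thus ?thesis using assms(1) by (simp add: power_0_left)
next
  case False
  define P where "P = (\<Prod>j<l. [:- (z ^ j * b), 1:])"
  define Q where "Q = monom 1 l - [:b ^ l:]"
  have "P = Q"
  proof (rule poly_eqI_degree_lead_coeff[of _ l _ "(\<lambda>j. z ^ j * b) ` {..<l}"])
    have "inj_on (\<lambda>j. z ^ j * b) {..<l}" using assms(3) False by (auto simp: inj_on_def)
    thus "l \<le> card ((\<lambda>j. z ^ j * b) ` {..<l})" by (simp add: card_image)
    have degP: "degree P = l" unfolding P_def by (subst degree_prod_sum_eq) auto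
    thus "degree P \<le> l" by simp
    show "degree Q \<le> l" unfolding Q_def by (intro degree_diff_le degree_monom_le) simp
    have "lead_coeff P = 1" unfolding P_def by (subst lead_coeff_prod) simp
    moreover have "coeff Q l = 1" unfolding Q_def using assms(1) by (simp add: coeff_pCons split: nat.splits)
    ultimately show "coeff P l = coeff Q l" by (simp add: degP)
  next
    fix x assume "x \<in> (\<lambda>j. z ^ j * b) ` {..<l}"
    then obtain j where j: "j < l" "x = z ^ j * b" by auto
    have "poly P x = 0" unfolding P_def poly_prod using j by (auto intro!: prod_zero bexI[of _ j])
    moreover have "(z ^ j) ^ l = 1" using assms(2) by (metis mult.commute power_mult power_one)
    hence "poly Q x = 0" unfolding Q_def by (simp add: poly_monom j(2) power_mult_distrib)
    ultimately show "poly P x = poly Q x" by simp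
  qed
  hence "poly P a = poly Q a" by simp
  thus ?thesis unfolding P_def Q_def by (simp add: poly_prod poly_monom)
qed

lemma prime_elem_dvd_prodE:
  fixes p :: "'b::comm_semiring_1"
  assumes "prime_elem p" "finite I" "p dvd prod f I"
  shows "\<exists>i\<in>I. p dvd f i"
  using assms(2,3)
proof (induction I rule: finite_induct)
  case empty
  with assms(1) show ?case by (auto dest: prime_elem_not_unit)
next
  case (insert i I)
  thus ?case using prime_elem_dvd_multD[OF assms(1), of "f i" "prod f I"] by auto
qed

lemma pcompose_power: "pcompose (p ^ n) r = pcompose p r ^ n"
  by (induction n) (simp_all add: pcompose_mult pcompose_1)

lemma pcompose_monom: "pcompose (monom c n) r = [:c:] * r ^ n"
  by (induction n) (simp_all add: monom_0 monom_Suc pcompose_pCons)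

text \<open>Horner's scheme: such a homomorphism is evaluation at the image of \<open>X\<close>.
  Degree above 1 makes \<open>X\<close> itself a reduced remainder.\<close>

lemma Kring_hom_eq_pcompose:
  fixes h1 h2 :: "'a::field poly fract poly"
  assumes hom: "\<phi> \<in> ring_hom (Kring h1) (Kring h2)" and const: "\<And>c. \<phi> [:c:] = [:c:]"
    and "degree h1 > 1" "degree x < degree h1"
  shows "\<phi> x = pcompose x (\<phi> [:0, 1:]) mod h2"
  using assms(4)
proof (induction x)
  case 0
  show ?case using const[of 0] by simp
next
  case (pCons a x)
  let ?X = "[:0, 1:] :: 'a poly fract poly"
  have carr: "u \<in> carrier (Kring h1)" if "degree u < degree h1" for u using that by (simp add: Kring_def Kset_def)
  have "degree x < degree h1" using pCons by (cases "x = 0") auto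
  note IH = pCons.IH[OF this]
  have X: "?X \<in> carrier (Kring h1)" and x: "x \<in> carrier (Kring h1)" and a: "[:a:] \<in> carrier (Kring h1)"
    using \<open>degree x < degree h1\<close> assms(3) by (auto intro: carr)
  have "\<phi> [:a:] \<in> carrier (Kring h2)" by (rule ring_hom_closed[OF hom a])
  hence deg2: "degree h2 > 0" by (simp add: const Kring_def Kset_def)
  have m: "(?X * x) mod h1 = ?X * x" using pCons.prems by (intro mod_poly_less) (cases "x = 0"; simp)
  hence "?X * x \<in> carrier (Kring h1)" using pCons.prems by (intro carr) (cases "x = 0"; simp)
  have "\<phi> (pCons a x) = \<phi> ([:a:] \<oplus>\<^bsub>Kring h1\<^esub> (?X * x))" by (simp add: Kring_def)
  also have "\<dots> = \<phi> [:a:] \<oplus>\<^bsub>Kring h2\<^esub> \<phi> (?X * x)"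
    by (rule ring_hom_add[OF hom a \<open>?X * x \<in> carrier (Kring h1)\<close>])
  also have "\<phi> (?X * x) = \<phi> (?X \<otimes>\<^bsub>Kring h1\<^esub> x)" using m by (simp add: Kring_def)
  also have "\<dots> = \<phi> ?X \<otimes>\<^bsub>Kring h2\<^esub> \<phi> x" by (rule ring_hom_mult[OF hom X x])
  finally have "\<phi> (pCons a x) = [:a:] + (\<phi> ?X * (pcompose x (\<phi> ?X) mod h2)) mod h2"
    using IH by (simp add: Kring_def const)
  also have "[:a:] = [:a:] mod h2" using deg2 by (simp add: mod_poly_less)
  finally show ?case by (simp add: pcompose_pCons mod_mult_right_eq poly_mod_add_left)
qed

context kummer
begin

lemma zeta_exists: "\<exists>z :: 'a poly fract. z ^ l = 1 \<and> z \<noteq> 1"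
proof -
  obtain z :: 'a where z: "z ^ l = 1" "z \<noteq> 1"
    using finite_field_root_of_unity[OF prime_l, where 'a='a] l_dvd by (auto simp: q_eq)
  have "to_fract [:z:] ^ l = to_fract [:z ^ l:]" by (simp add: poly_const_pow flip: to_fract_power)
  also have "\<dots> = 1" using z by (simp flip: one_pCons)
  finally have "to_fract [:z:] ^ l = 1" .
  moreover have "to_fract [:z:] \<noteq> to_fract 1" using z by (simp only: to_fract_eq_iff) (simp add: one_pCons)
  ultimately show ?thesis by auto
qed

text \<open>Any nontrivial choice is a primitive root of unity, because \<open>l\<close> is
  prime.\<close>

definition zeta :: "'a poly fract" where "zeta = (SOME z. z ^ l = 1 \<and> z \<noteq> 1)"

lemma zeta: "zeta ^ l = 1" "zeta \<noteq> 1"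
  using someI_ex[OF zeta_exists] by (simp_all add: zeta_def)

lemma zeta_nz [simp]: "zeta \<noteq> 0"
  using zeta(1) by (auto simp: power_0_left)

lemma inj_zeta: "inj_on (\<lambda>j. zeta ^ j) {..<l}"
proof -
  have *: False if "i < j" "j < l" "zeta ^ i = zeta ^ j" for i j
  proof -
    have "zeta ^ j = zeta ^ i * zeta ^ (j - i)" using that(1) by (simp flip: power_add)
    hence "0 dvd zeta ^ (j - i) - 1" using that by simp
    moreover have "0 dvd zeta ^ l - 1" by (simp add: zeta)
    moreover have "\<not> l dvd j - i" using that by (auto dest: dvd_imp_le)
    hence "coprime (j - i) l" using prime_l by (metis coprime_commute prime_imp_coprime)
    ultimately have "0 dvd zeta - 1" using that by (intro dvd_power_minus_one_coprime[of 0 zeta "j - i" l]) auto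
    thus False using zeta by simp
  qed
  show ?thesis
  proof (rule inj_onI)
    fix i j assume "i \<in> {..<l}" "j \<in> {..<l}" "zeta ^ i = zeta ^ j"
    thus "i = j" using *[of i j] *[of j i] by (cases i j rule: linorder_cases) auto
  qed
qed

text \<open>The Galois action \<open>X\<close> to \<open>zeta^j X\<close>, defined on all
  polynomials; it fixes \<open>h\<close> and therefore commutes with reduction.\<close>

definition zsubst :: "nat \<Rightarrow> 'a poly fract poly \<Rightarrow> 'a poly fract poly" where
  "zsubst j s = pcompose s [:0, zeta ^ j:]"

lemma coeff_zsubst: "coeff (zsubst j s) i = zeta ^ (j * i) * coeff s i"
  by (simp add: zsubst_def coeff_pcompose_linear power_mult)

lemma degree_zsubst [simp]: "degree (zsubst j s) = degree s"
  by (simp add: zsubst_def degree_pcompose)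

lemma zsubst_const [simp]: "zsubst j [:c:] = [:c:]"
  by (simp add: zsubst_def)

lemma zsubst_h: "zsubst j h = h"
proof (rule poly_eqI)
  fix i
  have "zeta ^ (j * l) = 1" by (metis mult.commute power_mult power_one zeta(1))
  thus "coeff (zsubst j h) i = coeff h i"
    by (auto simp: coeff_zsubst kummer_poly_def coeff_pCons split: nat.splits)
qed

lemma zsubst_mod: "zsubst j (s mod h) = zsubst j s mod h"
proof -
  have "s = (s div h) * h + s mod h" by (rule div_mult_mod_eq[symmetric])
  hence "zsubst j s = zsubst j (s div h) * h + zsubst j (s mod h)"
    using zsubst_h[of j] by (metis pcompose_add pcompose_mult zsubst_def)
  thus ?thesis by (simp add: mod_h_id)
qed

lemma zsubst_zsubst: "zsubst i (zsubst j s) = zsubst (i + j) s"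
  by (rule poly_eqI) (simp add: coeff_zsubst algebra_simps flip: power_add)

lemma bij_zsubst: "bij_betw (zsubst j) (Kset h) (Kset h)"
proof (rule bij_betw_byWitness[where f' = "zsubst (j * (l - 1))"])
  have "zeta ^ (j * l * i) = 1" for i by (metis mult.assoc mult.commute power_mult power_one zeta(1))
  moreover have "j * (l - 1) + j = j * l" by (metis Suc_pred' add.commute l_gt_0 mult_Suc_right)
  ultimately have "zsubst (j * (l - 1) + j) s = s" for s
    by (intro poly_eqI) (simp add: coeff_zsubst)
  thus "\<forall>a\<in>Kset h. zsubst (j * (l - 1)) (zsubst j a) = a" "\<forall>a\<in>Kset h. zsubst j (zsubst (j * (l - 1)) a) = a"
    by (simp_all add: zsubst_zsubst add.commute)
qed (auto simp: Kset_def)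

lemma zsubst_in_Kaut: "restrict (zsubst j) (Kset h) \<in> Kaut h"
proof -
  have "restrict (zsubst j) (Kset h) \<in> ring_iso (Kring h) (Kring h)"
  proof (rule ring_iso_memI)
    show "bij_betw (restrict (zsubst j) (Kset h)) (carrier (Kring h)) (carrier (Kring h))"
      using bij_betw_cong[of "Kset h" "restrict (zsubst j) (Kset h)" "zsubst j" "Kset h"] bij_zsubst[of j]
      by (simp add: Kring_def)
  next
    fix x y assume "x \<in> carrier (Kring h)" "y \<in> carrier (Kring h)"
    hence xy: "x \<in> Kset h" "y \<in> Kset h" by (simp_all add: Kring_def)
    moreover have "x + y \<in> Kset h" using xy by (auto simp: Kset_def intro: degree_add_less)
    moreover have "(x * y) mod h \<in> Kset h" by (simp add: Kset_def)
    ultimately show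
      "restrict (zsubst j) (Kset h) (x \<otimes>\<^bsub>Kring h\<^esub> y) =
        restrict (zsubst j) (Kset h) x \<otimes>\<^bsub>Kring h\<^esub> restrict (zsubst j) (Kset h) y"
      "restrict (zsubst j) (Kset h) (x \<oplus>\<^bsub>Kring h\<^esub> y) =
        restrict (zsubst j) (Kset h) x \<oplus>\<^bsub>Kring h\<^esub> restrict (zsubst j) (Kset h) y"
      by (simp_all add: Kring_def zsubst_mod) (simp_all add: zsubst_def pcompose_mult pcompose_add)
  qed (auto simp: Kring_def Kset_def, simp add: zsubst_def pcompose_1)
  thus ?thesis by (auto simp: Kaut_def Kset_def)
qed

lemma X_power_cong: "[[:0, 1:] ^ l = [:M:]] (mod h)"
proof -
  have "[:0, 1:] ^ l = (monom 1 l :: 'a poly fract poly)" by (simp add: monom_altdef)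
  thus ?thesis using monom_cong[of 1 l] by (simp add: monom_0)
qed

text \<open>The power \<open>X^l\<close> is not a reduced remainder, so the relation is transported
  as the product of \<open>X\<close> and \<open>X^(l-1)\<close> in \<open>Kring h\<close>.\<close>

lemma root_of_hom:
  fixes \<phi> h2
  assumes hom: "\<phi> \<in> ring_hom (Kring h) (Kring h2)" and const: "\<And>c. \<phi> [:c:] = [:c:]"
  shows "[\<phi> [:0, 1:] ^ l = [:M:]] (mod h2)"
proof -
  let ?X = "[:0, 1:] :: 'a poly fract poly" and ?Y = "monom 1 (l - 1) :: 'a poly fract poly"
  have deg: "degree ?Y < degree h" "degree ?X < degree h" using l_gt_1 by (simp_all add: degree_monom_eq)
  have carr: "?X \<in> carrier (Kring h)" "?Y \<in> carrier (Kring h)" using deg by (simp_all add: Kring_def Kset_def)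
  have "?X * ?Y = monom 1 (Suc (l - 1))" by (simp only: monom_Suc) simp
  also have "Suc (l - 1) = l" by simp
  finally have "(?X * ?Y) mod h = [:M:]" using monom_mod_h[of 1 l] by (simp add: monom_0)
  hence "[:M:] = \<phi> (?X \<otimes>\<^bsub>Kring h\<^esub> ?Y)" by (simp add: Kring_def const)
  also have "\<dots> = \<phi> ?X \<otimes>\<^bsub>Kring h2\<^esub> \<phi> ?Y" by (rule ring_hom_mult[OF hom carr])
  also have "\<dots> = (\<phi> ?X * (\<phi> ?X ^ (l - 1) mod h2)) mod h2"
    using Kring_hom_eq_pcompose[OF hom const _ deg(1)] l_gt_1
    by (simp add: Kring_def pcompose_monom flip: one_pCons)
  also have "\<dots> = (\<phi> ?X ^ Suc (l - 1)) mod h2" by (simp only: mod_mult_right_eq power_Suc)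
  also have "Suc (l - 1) = l" by simp
  finally show ?thesis by (metis cong_def mod_mod_trivial)
qed

end

context kummer_inert
begin

lemma prime_h: "prime_elem h"
  using irreducible_h by (rule field_poly_irreducible_imp_prime)

text \<open>The difference of the l-th powers splits into the factors \<open>y - zeta^j x\<close>,
  and the prime \<open>h\<close> divides one of them.\<close>

lemma power_cong_imp_zeta_multiple:
  assumes "[y ^ l = x ^ l] (mod h)" "degree x < l" "degree y < l"
  shows "\<exists>j<l. y = smult (zeta ^ j) x"
proof -
  have inj: "inj_on (\<lambda>j. [:zeta:] ^ j) {..<l}" using inj_zeta by (auto simp: inj_on_def poly_const_pow)
  have "y ^ l - x ^ l = (\<Prod>j<l. y - [:zeta:] ^ j * x)"
    by (rule power_minus_prod_roots_of_unity[OF _ _ inj]) (simp_all add: poly_const_pow zeta flip: one_pCons)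
  hence "h dvd (\<Prod>j<l. y - [:zeta:] ^ j * x)" using assms(1) by (simp add: cong_iff_dvd_diff)
  then obtain j where j: "j < l" "h dvd y - [:zeta:] ^ j * x"
    using prime_elem_dvd_prodE[OF prime_h] by blast
  have "[y = smult (zeta ^ j) x] (mod h)" using j(2) by (simp add: cong_iff_dvd_diff poly_const_pow)
  hence "y = smult (zeta ^ j) x" using assms(2,3) by (intro cong_imp_eq) auto
  with j(1) show ?thesis by blast
qed

lemma Kaut_eq: "Kaut h = (\<lambda>j. restrict (zsubst j) (Kset h)) ` {..<l}"
proof
  show "(\<lambda>j. restrict (zsubst j) (Kset h)) ` {..<l} \<subseteq> Kaut h" using zsubst_in_Kaut by auto
  show "Kaut h \<subseteq> (\<lambda>j. restrict (zsubst j) (Kset h)) ` {..<l}"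
  proof
    fix \<tau> assume "\<tau> \<in> Kaut h"
    hence \<tau>: "\<tau> \<in> ring_hom (Kring h) (Kring h)" "\<tau> \<in> extensional (Kset h)" "\<And>c. \<tau> [:c:] = [:c:]"
      by (auto simp: Kaut_def ring_iso_def)
    have "[\<tau> [:0, 1:] ^ l = [:0, 1:] ^ l] (mod h)"
      by (rule cong_trans[OF root_of_hom[OF \<tau>(1,3)] cong_sym[OF X_power_cong]])
    moreover have "\<tau> [:0, 1:] \<in> carrier (Kring h)"
      using l_gt_1 by (intro ring_hom_closed[OF \<tau>(1)]) (simp add: Kring_def Kset_def)
    ultimately obtain j where j: "j < l" "\<tau> [:0, 1:] = smult (zeta ^ j) [:0, 1:]"
      using power_cong_imp_zeta_multiple[of "\<tau> [:0, 1:]" "[:0, 1:]"] l_gt_1 by (auto simp: Kring_def Kset_def)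
    have "\<tau> x = zsubst j x" if "x \<in> Kset h" for x
    proof -
      have "\<tau> x = pcompose x (\<tau> [:0, 1:]) mod h"
        using that l_gt_1 by (intro Kring_hom_eq_pcompose[OF \<tau>(1,3)]) (simp_all add: Kset_def)
      also have "\<dots> = zsubst j x mod h" by (simp add: j(2) zsubst_def)
      finally show ?thesis using that by (simp add: mod_h_id Kset_def)
    qed
    hence "\<tau> = restrict (zsubst j) (Kset h)" using \<tau>(2) by (intro extensionalityI[of _ "Kset h"]) auto
    with j(1) show "\<tau> \<in> (\<lambda>j. restrict (zsubst j) (Kset h)) ` {..<l}" by blast
  qed
qed

lemma cyclic_ext_h: "cyclic_ext l h"
proof -
  have "inj_on (\<lambda>j. restrict (zsubst j) (Kset h)) {..<l}"
  proof (rule inj_onI)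
    fix i j assume ij: "i \<in> {..<l}" "j \<in> {..<l}" "restrict (zsubst i) (Kset h) = restrict (zsubst j) (Kset h)"
    have "[:0, 1:] \<in> Kset h" using l_gt_1 by (simp add: Kset_def)
    with ij(3) have "zsubst i [:0, 1:] = zsubst j [:0, 1:]" by (metis restrict_apply')
    hence "coeff (zsubst i [:0, 1:]) 1 = coeff (zsubst j [:0, 1:]) 1" by simp
    hence "zeta ^ i = zeta ^ j" by (simp add: coeff_zsubst)
    thus "i = j" using inj_zeta ij(1,2) by (auto dest: inj_onD)
  qed
  hence "card (Kaut h) = l" by (simp add: Kaut_eq card_image)
  moreover have "\<exists>\<sigma>\<in>Kaut h. \<forall>\<tau>\<in>Kaut h. \<exists>k. \<forall>x\<in>Kset h. \<tau> x = (\<sigma> ^^ k) x"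
  proof (rule bexI[OF _ zsubst_in_Kaut[of 1]], rule ballI)
    let ?\<sigma> = "restrict (zsubst 1) (Kset h)"
    fix \<tau> assume "\<tau> \<in> Kaut h"
    then obtain j where j: "\<tau> = restrict (zsubst j) (Kset h)" by (auto simp: Kaut_eq)
    have "(?\<sigma> ^^ k) x = zsubst k x" if "x \<in> Kset h" for k x
    proof (induction k)
      case 0
      show ?case by (simp add: zsubst_def)
    next
      case (Suc k)
      have "zsubst k x \<in> Kset h" using that by (simp add: Kset_def)
      with Suc show ?case by (simp add: zsubst_zsubst)
    qed
    thus "\<exists>k. \<forall>x\<in>Kset h. \<tau> x = (?\<sigma> ^^ k) x" using j by (intro exI[of _ j]) auto
  qed
  ultimately show ?thesis unfolding cyclic_ext_def using irreducible_h by simp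
qed

text \<open>Let \<open>y\<close> be the image of \<open>X\<close>. As \<open>y^l\<close> is the
  constant \<open>m1\<close>, the automorphism \<open>zsubst 1\<close> multiplies \<open>y\<close>
  by some \<open>zeta^j\<close>. The eigenspace for \<open>zeta^j\<close> is spanned by
  \<open>X^j\<close>, so \<open>y = c X^j\<close>, and the l-th power gives the relation. If
  \<open>j\<close> were 0, a constant and \<open>X\<close> would have the same image.\<close>

lemma kummer_iso:
  assumes "kummer m1 l q" "ext_iso (kummer_poly l m1) h"
  shows "\<exists>c j. 0 < j \<and> j < l \<and> to_fract m1 = c ^ l * M ^ j"
proof -
  interpret k1: kummer m1 l q by fact
  let ?X = "[:0, 1:] :: 'a poly fract poly"
  obtain \<phi> where \<phi>: "\<phi> \<in> ring_iso (Kring k1.h) (Kring h)" "\<And>c. \<phi> [:c:] = [:c:]"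
    using assms(2) by (auto simp: ext_iso_def)
  have hom: "\<phi> \<in> ring_hom (Kring k1.h) (Kring h)" and bij: "bij_betw \<phi> (Kset k1.h) (Kset h)"
    using \<phi>(1) by (auto simp: ring_iso_def Kring_def)
  define y where "y = \<phi> ?X"
  have X: "?X \<in> Kset k1.h" using l_gt_1 by (simp add: Kset_def)
  have y: "degree y < l" using bij X unfolding y_def by (auto simp: bij_betw_def Kset_def)
  have yl: "[y ^ l = [:to_fract m1:]] (mod h)" unfolding y_def by (rule k1.root_of_hom[OF hom \<phi>(2)])
  have "zsubst 1 (y ^ l mod h) = zsubst 1 ([:to_fract m1:] mod h)" using yl by (simp add: cong_def)
  hence "[zsubst 1 (y ^ l) = [:to_fract m1:]] (mod h)" by (simp add: zsubst_mod cong_def)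
  hence "[zsubst 1 y ^ l = [:to_fract m1:]] (mod h)" by (simp only: zsubst_def pcompose_power)
  hence "[zsubst 1 y ^ l = y ^ l] (mod h)" by (rule cong_trans[OF _ cong_sym[OF yl]])
  then obtain j where j: "j < l" "zsubst 1 y = smult (zeta ^ j) y"
    using power_cong_imp_zeta_multiple y by (metis degree_zsubst)
  have "coeff y i = 0" if "i \<noteq> j" for i
  proof (cases "i < l")
    case True
    have "zeta ^ i * coeff y i = zeta ^ j * coeff y i"
      using arg_cong[OF j(2), of "\<lambda>p. coeff p i"] by (simp add: coeff_zsubst)
    moreover have "zeta ^ i \<noteq> zeta ^ j" using inj_zeta that True j(1) by (auto dest: inj_onD)
    ultimately show ?thesis by simp
  qed (use y in \<open>auto simp: coeff_eq_0\<close>)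
  hence ymon: "y = monom (coeff y j) j" by (intro poly_eqI) auto
  have "y ^ l = monom (coeff y j ^ l) (j * l)" by (subst ymon) (simp add: monom_power)
  also have "[\<dots> = monom (coeff y j ^ l * M ^ j) 0] (mod h)"
    using monom_cong[of "coeff y j ^ l" "j * l"] by simp
  finally have "[y ^ l = [:coeff y j ^ l * M ^ j:]] (mod h)" by (simp only: monom_0)
  hence "[[:to_fract m1:] = [:coeff y j ^ l * M ^ j:]] (mod h)" by (rule cong_trans[OF cong_sym[OF yl]])
  hence "[:to_fract m1:] = [:coeff y j ^ l * M ^ j:]" by (rule cong_imp_eq) auto
  hence "to_fract m1 = coeff y j ^ l * M ^ j" by simp
  moreover have "j \<noteq> 0"
  proof
    assume "j = 0"
    hence "y = [:coeff y 0:]" using ymon by (simp add: monom_0)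
    hence "\<phi> ?X = \<phi> [:coeff y 0:]" unfolding y_def \<phi>(2) .
    moreover have "[:coeff y 0:] \<in> Kset k1.h" by (simp add: Kset_def)
    ultimately have "?X = [:coeff y 0:]" using bij X by (meson bij_betw_def inj_onD)
    thus False by simp
  qed
  ultimately show ?thesis using j(1) by blast
qed

end

section \<open>Valuations at a prime of A\<close>

lemma irreducible_power_factor:
  fixes r a :: "'a::field poly"
  assumes "irreducible r" "a \<noteq> 0"
  shows "\<exists>n b. a = r ^ n * b \<and> \<not> r dvd b"
  using assms(2)
proof (induction "degree a" arbitrary: a rule: less_induct)
  case less
  show ?case
  proof (cases "r dvd a")
    case True
    then obtain a' where a': "a = r * a'" by (auto elim: dvdE)
    hence "degree a' < degree a"
      using less.prems irreducible_degree_pos[OF assms(1)] by (auto simp: degree_mult_eq)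
    then obtain n b where "a' = r ^ n * b" "\<not> r dvd b" using less.hyps[of a'] less.prems a' by auto
    with a' show ?thesis by (intro exI[of _ "Suc n"] exI[of _ b]) simp
  next
    case False
    thus ?thesis by (intro exI[of _ 0] exI[of _ a]) simp
  qed
qed

lemma irreducible_power_factor_unique:
  fixes r a b :: "'a::field poly"
  assumes "irreducible r" "r ^ n * a = r ^ k * b" "\<not> r dvd a" "\<not> r dvd b"
  shows "n = k"
proof -
  have *: False if "n < k" "r ^ n * a = r ^ k * b" "\<not> r dvd a" for n k a b
  proof -
    have "r ^ k = r ^ n * r ^ (k - n)" using that by (simp flip: power_add)
    with that(2) assms(1) have "a = r ^ (k - n) * b" by (auto simp: irreducible_def mult.assoc)
    moreover have "r dvd r ^ (k - n)" using that by simp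
    ultimately show False using that by (metis dvd_mult2)
  qed
  show ?thesis using *[of n k a b] *[of k n b a] assms by (metis linorder_neqE_nat)
qed

text \<open>Valuations at \<open>r\<close> satisfy \<open>n1 + t l = s l + n2 j\<close>. The pair
  \<open>(n1, n2) = (1, 0)\<close> forces \<open>l\<close> to divide 1, and \<open>(0, 1)\<close>
  forces \<open>l\<close> to divide \<open>j\<close>. Both cases are recorded because the later
  parameter, which owns the new prime, may stand on either side of the relation.\<close>

lemma kummer_relation_valuation:
  fixes m1 m2 r :: "'a::field poly"
  assumes l: "l > 1" and j: "0 < j" "j < l" and eq: "to_fract m1 = c ^ l * to_fract m2 ^ j"
    and r: "irreducible r" "m1 \<noteq> 0" "m2 \<noteq> 0"
  shows "\<not> (r dvd m1 \<and> \<not> r ^ 2 dvd m1 \<and> \<not> r dvd m2)" "\<not> (r dvd m2 \<and> \<not> r ^ 2 dvd m2 \<and> \<not> r dvd m1)"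
proof -
  note prime = field_poly_irreducible_imp_prime[OF r(1)]
  obtain a b where ab: "c = to_fract a / to_fract b" "b \<noteq> 0" by (rule fract_eq_quotient)
  have "to_fract (m1 * b ^ l) = to_fract (a ^ l * m2 ^ j)" using eq ab by (simp add: power_divide)
  hence rel: "m1 * b ^ l = a ^ l * m2 ^ j" by (simp only: to_fract_eq_iff)
  have "a \<noteq> 0" using rel r ab l by (auto simp: power_0_left)
  obtain s a' where a': "a = r ^ s * a'" "\<not> r dvd a'" using irreducible_power_factor[OF r(1) \<open>a \<noteq> 0\<close>] by blast
  obtain t b' where b': "b = r ^ t * b'" "\<not> r dvd b'" using irreducible_power_factor[OF r(1) ab(2)] by blast
  obtain n1 m1' where m1: "m1 = r ^ n1 * m1'" "\<not> r dvd m1'" using irreducible_power_factor[OF r(1,2)] by blast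
  obtain n2 m2' where m2: "m2 = r ^ n2 * m2'" "\<not> r dvd m2'" using irreducible_power_factor[OF r(1,3)] by blast
  have "r ^ (n1 + t * l) * (m1' * b' ^ l) = r ^ (s * l + n2 * j) * (a' ^ l * m2' ^ j)"
    using rel unfolding a' b' m1 m2 by (simp add: power_mult_distrib power_add mult_ac flip: power_mult)
  moreover have "\<not> r dvd m1' * b' ^ l" "\<not> r dvd a' ^ l * m2' ^ j"
    using prime a'(2) b'(2) m1(2) m2(2) by (meson prime_elem_dvd_mult_iff prime_elem_dvd_power)+
  ultimately have val: "n1 + t * l = s * l + n2 * j" by (rule irreducible_power_factor_unique[OF r(1)])
  have n0: "n = 0" if "\<not> r dvd r ^ n * u" for n u using that by (cases n) auto
  have n1: "n = 1" if "r dvd r ^ n * u" "\<not> r ^ 2 dvd r ^ n * u" "\<not> r dvd u" for n u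
  proof -
    have "n \<noteq> 0" using that(1,3) by (cases n) auto
    moreover have "\<not> n \<ge> 2" using that(2) by (meson dvd_mult2 le_imp_power_dvd)
    ultimately show ?thesis by simp
  qed
  show "\<not> (r dvd m1 \<and> \<not> r ^ 2 dvd m1 \<and> \<not> r dvd m2)"
  proof
    assume *: "r dvd m1 \<and> \<not> r ^ 2 dvd m1 \<and> \<not> r dvd m2"
    hence "n1 = 1" "n2 = 0" using n1[of n1 m1'] n0[of n2 m2'] m1 m2 by auto
    hence "1 + t * l = s * l" using val by simp
    hence "l dvd 1" by (metis dvd_add_left_iff dvd_triv_right)
    thus False using l by simp
  qed
  show "\<not> (r dvd m2 \<and> \<not> r ^ 2 dvd m2 \<and> \<not> r dvd m1)"
  proof
    assume *: "r dvd m2 \<and> \<not> r ^ 2 dvd m2 \<and> \<not> r dvd m1"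
    hence "n2 = 1" "n1 = 0" using n1[of n2 m2'] n0[of n1 m1'] m1 m2 by auto
    hence "t * l = s * l + j" using val by simp
    hence "l dvd j" by (metis dvd_add_right_iff dvd_triv_right)
    thus False using j by (auto dest: dvd_imp_le)
  qed
qed

subsection \<open>The discriminant\<close>

context kummer
begin

text \<open>Multiplication by \<open>X^k\<close> moves the basis cyclically up to scalars, so its
  matrix has an empty diagonal unless \<open>k = 0\<close>.\<close>

lemma Ktrace_monom:
  assumes "k < l"
  shows "Ktrace h (monom c k) = (if k = 0 then of_nat l * c else 0)"
proof -
  have "coeff ((monom c k * monom 1 i) mod h) i = (if k = 0 then c else 0)" if i: "i < l" for i
  proof (cases "k = 0")
    case True
    thus ?thesis using i by (simp add: mult_monom monom_mod_h)
  next
    case False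
    have "(k + i) mod l \<noteq> i"
    proof
      assume eq: "(k + i) mod l = i"
      hence "(k + i) mod l = (0 + i) mod l" using i by simp
      hence "[k + i = 0 + i] (mod l)" by (simp add: cong_def)
      hence "[k = 0] (mod l)" by (simp only: cong_add_rcancel_nat)
      thus False using assms False by (simp add: cong_def)
    qed
    thus ?thesis using False by (simp add: mult_monom monom_mod_h)
  qed
  thus ?thesis by (simp add: Ktrace_def)
qed

lemma Ktrace_monom_mult:
  "Ktrace h ((monom 1 i * monom 1 j) mod h) = (if l dvd i + j then to_fract (of_nat l * m ^ ((i + j) div l)) else 0)"
  by (simp add: mult_monom monom_mod_h Ktrace_monom dvd_eq_mod_eq_0)

lemma disc_coprime_h:
  assumes "coprime m g"
  shows "disc_coprime h g"
proof -
  \<comment> \<open>The map \<open>i\<close> to \<open>-i\<close> modulo \<open>l\<close>: the trace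
    of \<open>X^(i+j)\<close> is zero unless \<open>l\<close> divides \<open>i + j\<close>, so this
    is the only permutation contributing to the determinant.\<close>
  define \<rho> where "\<rho> = (\<lambda>i. if i < l then (l - i) mod l else i)"
  have \<rho>: "\<rho> permutes {..<l}"
  proof (rule inj_imp_permutes)
    show "inj_on \<rho> {..<l}"
    proof (rule inj_onI)
      fix i j assume ij: "i \<in> {..<l}" "j \<in> {..<l}" "\<rho> i = \<rho> j"
      have "\<rho> (\<rho> k) = k" if "k < l" for k using that by (cases "k = 0") (auto simp: \<rho>_def)
      with ij show "i = j" by (metis lessThan_iff)
    qed
  qed (auto simp: \<rho>_def)
  define t where "t = (\<lambda>i j. Ktrace h ((monom 1 i * monom 1 j) mod h))"
  define d where "d = of_int (sign \<rho>) * (\<Prod>i<l. of_nat l * m ^ ((i + \<rho> i) div l))"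
  have "Kdisc h (\<lambda>i. monom 1 i) = (\<Sum>\<pi> | \<pi> permutes {..<l}. of_int (sign \<pi>) * (\<Prod>i<l. t i (\<pi> i)))"
    by (simp add: Kdisc_def t_def)
  also have "\<dots> = (\<Sum>\<pi>\<in>{\<rho>}. of_int (sign \<pi>) * (\<Prod>i<l. t i (\<pi> i)))"
  proof (rule sum.mono_neutral_right)
    show "\<forall>\<pi>\<in>{\<pi>. \<pi> permutes {..<l}} - {\<rho>}. of_int (sign \<pi>) * (\<Prod>i<l. t i (\<pi> i)) = 0"
    proof
      fix \<pi> assume \<pi>: "\<pi> \<in> {\<pi>. \<pi> permutes {..<l}} - {\<rho>}"
      have "\<exists>i<l. \<not> l dvd i + \<pi> i"
      proof (rule ccontr)
        assume *: "\<nexists>i. i < l \<and> \<not> l dvd i + \<pi> i"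
        have "\<pi> i = \<rho> i" for i
        proof (cases "i < l")
          case True
          have "\<pi> i < l" using \<pi> True permutes_in_image[of \<pi> "{..<l}" i] by simp
          obtain k where k: "i + \<pi> i = l * k" using * True by (auto elim: dvdE)
          \<comment> \<open>Both summands are below \<open>l\<close>, so a sum divisible by
            \<open>l\<close> is 0 or \<open>l\<close>; either value determines
            \<open>\<pi> i\<close>.\<close>
          have "l * k < l * 2" using True \<open>\<pi> i < l\<close> k by linarith
          hence "k = 0 \<or> k = 1" by auto
          thus ?thesis using k True \<open>\<pi> i < l\<close> by (auto simp: \<rho>_def)
        next
          case False
          thus ?thesis using \<pi> by (auto simp: \<rho>_def permutes_def)
        qed
        with \<pi> show False by auto
      qed
      hence "\<exists>i<l. t i (\<pi> i) = 0" by (auto simp: t_def Ktrace_monom_mult)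
      thus "of_int (sign \<pi>) * (\<Prod>i<l. t i (\<pi> i)) = 0" by (auto intro!: prod_zero)
    qed
  qed (use \<rho> in \<open>auto intro: finite_permutations\<close>)
  also have "\<dots> = of_int (sign \<rho>) * (\<Prod>i<l. to_fract (of_nat l * m ^ ((i + \<rho> i) div l)))"
  proof -
    have "l dvd i + \<rho> i" if "i < l" for i using that by (cases "i = 0") (auto simp: \<rho>_def)
    thus ?thesis by (simp add: t_def Ktrace_monom_mult)
  qed
  also have "\<dots> = to_fract d"
  proof -
    have "to_fract (prod f I) = (\<Prod>i\<in>I. to_fract (f i))" for f :: "nat \<Rightarrow> 'a poly" and I
      by (induction I rule: infinite_finite_induct) auto
    thus ?thesis by (cases \<rho> rule: sign_cases) (simp_all add: d_def)
  qed
  finally have "Kdisc h (\<lambda>i. monom 1 i) = Fract d 1" by (simp add: to_fract_def)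
  moreover have "monom 1 i \<in> OK h" if "i < l" for i
    using that integral_polys_monom[of 1 i] by (intro integral_polys_degree_OK) (simp_all add: degree_monom_eq)
  ultimately have d: "d \<in> disc_gens h" unfolding disc_gens_def by force
  have "\<not> r dvd d" if r: "irreducible r" "r dvd g" for r
  proof
    assume dvd: "r dvd d"
    note prime = field_poly_irreducible_imp_prime[OF r(1)]
    have "r dvd (\<Prod>i<l. of_nat l * m ^ ((i + \<rho> i) div l))"
      using dvd by (cases \<rho> rule: sign_cases) (simp_all add: d_def)
    then obtain i where "r dvd of_nat l * m ^ ((i + \<rho> i) div l)"
      using prime_elem_dvd_prodE[OF prime] by blast
    hence "r dvd of_nat l \<or> r dvd m"
      using prime by (meson prime_elem_dvd_multD prime_elem_dvd_power)
    thus False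
    proof
      assume "r dvd m"
      with r(2) assms have "r dvd 1" by (meson coprime_common_divisor)
      thus False using r(1) by (auto simp: irreducible_def)
    next
      assume "r dvd of_nat l"
      moreover have "of_nat l \<noteq> (0 :: 'a)" using finite_field_of_nat_divisor_neq_0 l_dvd by (simp add: q_eq)
      hence "(of_nat l :: 'a poly) dvd 1" by (simp add: of_nat_poly is_unit_pCons_iff)
      ultimately show False using r(1) by (meson dvd_trans irreducible_not_unit)
    qed
  qed
  with d show ?thesis unfolding disc_coprime_def by blast
qed

end

section \<open>Infinitely many cyclic extensions\<close>

lemma irreducible_dvd_irreducible:
  fixes r s :: "'b::comm_semiring_1"
  assumes "irreducible r" "irreducible s" "r dvd s"
  shows "s dvd r"
proof -
  obtain t where t: "s = r * t" using assms(3) by (auto elim: dvdE)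
  with assms have "t dvd 1" using irreducibleD by (metis irreducible_not_unit)
  then obtain t' where "t * t' = 1" by (metis dvdE)
  hence "r = s * t'" using t by (simp add: mult.assoc)
  thus ?thesis by simp
qed

text \<open>Chinese remaindering with \<open>m = n\<close> modulo \<open>p\<close> and
  \<open>m = r\<close> modulo \<open>g' r^2\<close>, where \<open>g = p g'\<close>. The first makes
  \<open>m\<close> a non-residue; the second makes \<open>m\<close> exactly divisible by
  \<open>r\<close> and, as \<open>r\<close> does not divide \<open>g\<close>, prime to
  \<open>g'\<close>. The argument \<open>N\<close> collects what the new prime \<open>r\<close> has
  to avoid.\<close>

lemma kummer_parameter_exists:
  fixes g p N :: "'a::{field,finite} poly"
  assumes q: "q = card (UNIV :: 'a set)" and l: "prime l" "l dvd q - 1"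
    and g: "squarefree g" "g \<noteq> 0" and p: "irreducible p" "p dvd g" and N: "N \<noteq> 0"
  shows "\<exists>m r. kummer_inert m l q p \<and> coprime m g \<and>
    irreducible r \<and> r dvd m \<and> \<not> r ^ 2 dvd m \<and> \<not> r dvd N"
proof -
  let ?e = "(q ^ degree p - 1) div l"
  obtain g' where g': "g = p * g'" using p(2) by (auto elim: dvdE)
  have pg': "\<not> p dvd g'"
  proof
    assume "p dvd g'"
    hence "p ^ 2 dvd g" using g' by (simp add: power2_eq_square mult_dvd_mono)
    hence "p dvd 1" using g(1) by (simp add: squarefreeD)
    thus False using p(1) by (auto simp: irreducible_def)
  qed
  obtain r where r: "irreducible r" "\<not> r dvd N * g" using infinitely_many_irreducible_poly[of "N * g"] N g(2) by auto
  have rN: "\<not> r dvd N" and rg: "\<not> r dvd g" using r(2) by (auto simp: dvd_mult dvd_mult2)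
  have pr: "\<not> p dvd r" using irreducible_dvd_irreducible[OF p(1) r(1)] rg p(2) by (meson dvd_trans)
  have q1: "q > 1" using card_mono[of "UNIV :: 'a set" "{0, 1}"] by (simp add: q)
  have "q - 1 dvd q ^ degree p - 1" using q1 by (intro minus_one_dvd_power_minus_one) simp
  hence ldvd: "l dvd q ^ degree p - 1" using l(2) by (rule dvd_trans[rotated])
  obtain n where n: "\<not> p dvd n" "\<not> p dvd n ^ ?e - 1"
    using power_nonresidue_exists[OF p(1) l(1)] ldvd by (auto simp: q)
  have "\<not> p dvd g' * r ^ 2"
    using field_poly_irreducible_imp_prime[OF p(1)] pg' pr by (meson prime_elem_dvd_multD prime_elem_dvd_power)
  then obtain u v where uv: "u * p + v * (g' * r ^ 2) = 1" using field_poly_irreducible_bezout[OF p(1)] by blast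
  define m where "m = r * (u * p) + n * (v * (g' * r ^ 2))"
  have up: "u * p = 1 - v * (g' * r ^ 2)" using uv by (simp add: eq_diff_eq)
  have vg: "v * (g' * r ^ 2) = 1 - u * p" using uv by (simp add: eq_diff_eq add.commute)
  have mn: "m - n = p * (u * (r - n))" unfolding m_def vg by (simp add: algebra_simps)
  have mr: "m = r + g' * (r ^ 2 * (v * (n - r)))" unfolding m_def up by (simp add: algebra_simps)
  have pm: "\<not> p dvd m"
  proof
    assume "p dvd m"
    hence "p dvd m - (m - n)" using mn by (metis dvd_diff dvd_triv_left)
    with n(1) show False by simp
  qed
  have nonres: "\<not> p dvd m ^ ?e - 1"
  proof
    assume "p dvd m ^ ?e - 1"
    moreover have "p dvd m ^ ?e - n ^ ?e"
      unfolding power_diff_sumr2 mn mult.assoc by (rule dvd_triv_left)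
    ultimately have "p dvd (m ^ ?e - 1) - (m ^ ?e - n ^ ?e)" by (rule dvd_diff)
    with n(2) show False by simp
  qed
  have rm: "r dvd m" unfolding mr by (simp add: power2_eq_square)
  have r2m: "\<not> r ^ 2 dvd m"
  proof
    assume "r ^ 2 dvd m"
    hence "r ^ 2 dvd r" unfolding mr by (metis dvd_add_left_iff dvd_mult dvd_triv_left)
    then obtain k where "r = r ^ 2 * k" ..
    hence "r * 1 = r * (r * k)" by (simp add: power2_eq_square mult.assoc)
    hence "1 = r * k" using r(1) by (subst (asm) mult_left_cancel) (auto simp: irreducible_def)
    hence "r dvd 1" ..
    thus False using r(1) by (auto simp: irreducible_def)
  qed
  have m0: "m \<noteq> 0" using pm by auto
  have "coprime m g"
  proof (rule coprimeI)
    fix c assume c: "c dvd m" "c dvd g"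
    hence c0: "c \<noteq> 0" using m0 by auto
    show "c dvd 1"
    proof (rule ccontr)
      assume "\<not> c dvd 1"
      hence "degree c > 0" using c0 by (simp add: is_unit_iff_degree)
      then obtain s where s: "irreducible s" "s dvd c" using irreducible_dvd_field_poly_exists by blast
      have sm: "s dvd m" and "s dvd p * g'" using s c g' dvd_trans by blast+
      hence "s dvd p \<or> s dvd g'" using field_poly_irreducible_imp_prime[OF s(1)] by (meson prime_elem_dvd_multD)
      thus False
      proof
        assume "s dvd p"
        hence "p dvd s" using irreducible_dvd_irreducible s(1) p(1) by blast
        with sm pm show False by (meson dvd_trans)
      next
        assume sg: "s dvd g'"
        hence "s dvd r" using sm unfolding mr by (metis dvd_add_left_iff dvd_mult2)
        hence "r dvd s" using irreducible_dvd_irreducible s(1) r(1) by blast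
        hence "r dvd g" using sg g' by (meson dvd_mult dvd_trans)
        with rg show False ..
      qed
    qed
  qed
  moreover have "kummer_inert m l q p"
    by unfold_locales (use q l m0 p pm nonres in auto)
  ultimately show ?thesis using r(1) rm r2m rN by blast
qed

theorem theorem5p6:
  fixes g :: "'a::{field,finite} poly" and l :: nat
  assumes "card (UNIV :: 'a set) \<ge> 3"
    and "degree g > 0" and "squarefree g" and "\<not> carmichael_poly g"
    and "prime l" and "l dvd card (UNIV :: 'a set) - 1"
  shows "\<exists>H :: 'a poly fract poly set. infinite H \<and>
           (\<forall>h\<in>H. cyclic_ext l h \<and> disc_coprime h g \<and> \<not> carmichael_in h g) \<and>
           (\<forall>h1\<in>H. \<forall>h2\<in>H. h1 \<noteq> h2 \<longrightarrow> \<not> ext_iso h1 h2)"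
proof -
  define q where "q = card (UNIV :: 'a set)"
  have g0: "g \<noteq> 0" using assms(2) by auto
  obtain p where p: "irreducible p" "p dvd g" "irreducible g \<or> \<not> degree p dvd degree g"
    using korselt_carmichael_poly[OF assms(2,3)] assms(4) by (cases "irreducible g") (blast intro: dvd_refl)+
  \<comment> \<open>In a triple \<open>(m, r, N)\<close>, \<open>N\<close> is a common multiple of
    all parameters chosen so far; the next prime is taken outside it, so it divides no earlier
    parameter.\<close>
  define good where "good = (\<lambda>(m, r, N). kummer_inert m l q p \<and> coprime m g \<and>
    irreducible r \<and> r dvd m \<and> \<not> r ^ 2 dvd m \<and> N \<noteq> 0 \<and> m dvd N)"
  have step: "\<exists>m r N'. good (m, r, N') \<and> \<not> r dvd N \<and> N dvd N'" if N0: "N \<noteq> 0" for N :: "'a poly"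
  proof -
    obtain m r where mr: "kummer_inert m l q p" "coprime m g" "irreducible r" "r dvd m" "\<not> r ^ 2 dvd m" "\<not> r dvd N"
      using kummer_parameter_exists[OF q_def assms(5) _ assms(3) g0 p(1,2) N0] assms(6)
      by (auto simp: q_def)
    interpret kummer_inert m l q p by fact
    have "good (m, r, m * N)" using mr N0 m_nz by (simp add: good_def)
    thus ?thesis using mr(6) by (intro exI[of _ m] exI[of _ r] exI[of _ "m * N"]) simp
  qed
  obtain f where f: "\<And>n. good (f n)"
    "\<And>n. \<not> fst (snd (f (Suc n))) dvd snd (snd (f n)) \<and> snd (snd (f n)) dvd snd (snd (f (Suc n)))"
  proof -
    have "\<exists>f. \<forall>n. good (f n) \<and>
      (\<not> fst (snd (f (Suc n))) dvd snd (snd (f n)) \<and> snd (snd (f n)) dvd snd (snd (f (Suc n))))"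
    proof (rule dependent_nat_choice)
      show "\<exists>x. good x" using step[of 1] by auto
      fix x assume "good x"
      hence "snd (snd x) \<noteq> 0" by (auto simp: good_def split: prod.splits)
      from step[OF this] show "\<exists>y. good y \<and> (\<not> fst (snd y) dvd snd (snd x) \<and> snd (snd x) dvd snd (snd y))"
        by auto
    qed
    thus ?thesis using that by blast
  qed
  define m where "m = (\<lambda>i. fst (f i))"
  define r where "r = (\<lambda>i. fst (snd (f i)))"
  define N where "N = (\<lambda>i. snd (snd (f i)))"
  have good: "kummer_inert (m i) l q p" "coprime (m i) g" "irreducible (r i)" "r i dvd m i"
    "\<not> r i ^ 2 dvd m i" "m i dvd N i" for i
    using f(1)[of i] by (auto simp: good_def m_def r_def N_def split: prod.splits)
  have N_Suc: "\<not> r (Suc i) dvd N i" "N i dvd N (Suc i)" for i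
    using f(2)[of i] by (simp_all add: r_def N_def)
  have N_mono: "N i dvd N (i + k)" for i k
    by (induction k) (auto intro: dvd_trans N_Suc(2))
  have r_m: "\<not> r j dvd m i" if "i < j" for i j
  proof
    assume "r j dvd m i"
    \<comment> \<open>The index is \<open>j - 1\<close>: \<open>m i\<close> divides
      \<open>N i\<close>, which divides \<open>N (j - 1)\<close>, the last multiple that
      \<open>r j\<close> was chosen to avoid.\<close>
    hence "r j dvd N (i + (j - i - 1))" using good(6) N_mono by (meson dvd_trans)
    thus False using N_Suc(1)[of "j - 1"] that by simp
  qed
  have k: "kummer (m i) l q" for i using good(1) by (rule kummer_inert.axioms(1))
  have non_iso: "\<not> ext_iso (kummer_poly l (m i)) (kummer_poly l (m j))" if "i \<noteq> j" for i j
  proof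
    assume "ext_iso (kummer_poly l (m i)) (kummer_poly l (m j))"
    from kummer_inert.kummer_iso[OF good(1) k this]
    obtain c e where ce: "0 < e" "e < l" "to_fract (m i) = c ^ l * to_fract (m j) ^ e" by blast
    have 0: "m i \<noteq> 0" "m j \<noteq> 0" using k kummer.m_nz by blast+
    show False
    \<comment> \<open>A new prime is known to avoid only earlier parameters, so the valuation is
      taken at the prime of the larger index.\<close>
    proof (cases "i < j")
      case True
      thus ?thesis using kummer_relation_valuation(2)[OF prime_gt_1_nat[OF assms(5)] ce good(3)[of j] 0]
          good(4,5)[of j] r_m[of i j] by blast
    next
      case False
      thus ?thesis using kummer_relation_valuation(1)[OF prime_gt_1_nat[OF assms(5)] ce good(3)[of i] 0]
          good(4,5)[of i] r_m[of j i] that by auto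
    qed
  qed
  have inj: "inj (\<lambda>i. kummer_poly l (m i))"
  proof (rule injI)
    fix i j assume "kummer_poly l (m i) = kummer_poly l (m j)"
    hence "m i = m j" by (simp add: kummer_poly_def)
    thus "i = j" using r_m[of i j] r_m[of j i] good(4)[of i] good(4)[of j]
      by (cases i j rule: linorder_cases) auto
  qed
  show ?thesis
  proof (intro exI[of _ "range (\<lambda>i. kummer_poly l (m i))"] conjI)
    show "infinite (range (\<lambda>i. kummer_poly l (m i)))" using inj by (rule range_inj_infinite)
    show "\<forall>h\<in>range (\<lambda>i. kummer_poly l (m i)). cyclic_ext l h \<and> disc_coprime h g \<and> \<not> carmichael_in h g"
      using kummer_inert.cyclic_ext_h[OF good(1)] kummer.disc_coprime_h[OF k good(2)]
        kummer_inert.not_carmichael_in[OF good(1) p(2) assms(2) good(2) p(3)] by auto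
    show "\<forall>h1\<in>range (\<lambda>i. kummer_poly l (m i)). \<forall>h2\<in>range (\<lambda>i. kummer_poly l (m i)).
      h1 \<noteq> h2 \<longrightarrow> \<not> ext_iso h1 h2"
    proof (intro ballI impI)
      fix h1 h2 assume h: "h1 \<in> range (\<lambda>i. kummer_poly l (m i))" "h2 \<in> range (\<lambda>i. kummer_poly l (m i))" "h1 \<noteq> h2"
      then obtain i j where "h1 = kummer_poly l (m i)" "h2 = kummer_poly l (m j)" by (elim rangeE)
      with h(3) non_iso show "\<not> ext_iso h1 h2" by (cases "i = j") simp_all
    qed
  qed
qed

end
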